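(* Let $f=(f_1,\ldots,f_m)$ with $f_i\in\mathbb{Q}[x_1,\ldots,x_n]$ for $i=1,\ldots,m$, and let $\mathcal{I}=\langle f_1,\ldots,f_m\rangle$ be a zero-dimensional radical ideal. Given $z^*\in\mathbb{Q}^n$ and $\varepsilon\in\mathbb{Q}_+$, define $g(x):=\|x-z^*\|_2^2-\varepsilon^2\in\mathbb{Q}[x_1,\ldots,x_n]$. Then $$\sigma(H_1(\mathcal{I}))=\sigma(H_g(\mathcal{I}))$$ if and only if there is no real root of $\mathcal{I}$ within the closed ball in $\mathbb{R}^n$ of radius $\varepsilon$ around $z^*$.
   Context: Here $\|x-z^*\|_2^2$ denotes the polynomial $\sum_{i=1}^n(x_i-z^*_i)^2$. Hermite matrix: fix a monomial basis $\mathcal{B}=\{x^{\alpha_1},\ldots,x^{\alpha_k}\}$ of $A=\mathbb{R}[x_1,\ldots,x_n]/\mathcal{I}$ (meaning modulo the ideal generated by $f_1,\ldots,f_m$). For a polynomial $h$, $H_h(\mathcal{I}):=[\mathrm{Tr}(\mu_{h\,x^{\alpha_i+\alpha_j}})]_{i,j=1}^k$, where $\mu_p:A\to A$ is multiplication by $p$; it is a real symmetric matrix. $H_1$ is the case $h=1$. Signature: for a real symmetric matrix $A$, $\sigma(A)$ is the number of positive eigenvalues minus the number of negative eigenvalues (counted with multiplicity). A real root of $\mathcal{I}$ is a point of $V(\mathcal{I})\cap\mathbb{R}^n$. *)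

theory Defs
  imports
    "HOL-Analysis.Analysis"
    "HOL-Library.Poly_Mapping"
    "Jordan_Normal_Form.Char_Poly"
begin

(* '$' is reserved for components of points in 'a ^ 'n. *)
no_notation vec_index (infixl "$" 100)

section \<open>Multivariate polynomials\<close>

text \<open>Polynomials over \<^typ>\<open>'a\<close> in finitely many variables indexed by \<^typ>\<open>'n\<close>: finitely supported
  maps from exponent vectors to coefficients, with the convolution product of
  \<^theory>\<open>HOL-Library.Poly_Mapping\<close>.\<close>

type_synonym ('n, 'a) mpoly = "('n \<Rightarrow>\<^sub>0 nat) \<Rightarrow>\<^sub>0 'a"

definition mmonom :: "('n \<Rightarrow>\<^sub>0 nat) \<Rightarrow> 'a::zero \<Rightarrow> ('n, 'a) mpoly" where
  "mmonom \<alpha> c = Poly_Mapping.single \<alpha> c"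

definition mconst :: "'a::zero \<Rightarrow> ('n, 'a) mpoly" where
  "mconst c = mmonom 0 c"

definition mvar :: "'n \<Rightarrow> ('n, 'a::zero_neq_one) mpoly" where
  "mvar i = mmonom (Poly_Mapping.single i 1) 1"

definition meval :: "'a::comm_semiring_1 ^ 'n \<Rightarrow> ('n::finite, 'a) mpoly \<Rightarrow> 'a" where
  "meval x p = (\<Sum>\<alpha> \<in> Poly_Mapping.keys p.
     Poly_Mapping.lookup p \<alpha> * (\<Prod>i\<in>UNIV. (x $ i) ^ Poly_Mapping.lookup \<alpha> i))"

definition real_mpoly :: "('n, rat) mpoly \<Rightarrow> ('n, real) mpoly" where
  "real_mpoly p = Poly_Mapping.map of_rat p"

definition complex_mpoly :: "('n, real) mpoly \<Rightarrow> ('n, complex) mpoly" where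
  "complex_mpoly p = Poly_Mapping.map complex_of_real p"

section \<open>Ideals and their zeros\<close>

text \<open>The ideal generated by a set is its span in the ring regarded as a module over itself.\<close>

definition ideal_gen :: "'a::comm_ring_1 set \<Rightarrow> 'a set" where
  "ideal_gen F = module.span (*) F"

definition radical_ideal :: "'a::comm_ring_1 set \<Rightarrow> bool" where
  "radical_ideal I \<longleftrightarrow> (\<forall>p. \<forall>k\<ge>1. p ^ k \<in> I \<longrightarrow> p \<in> I)"

definition variety :: "('n::finite, real) mpoly set \<Rightarrow> (complex ^ 'n) set" where
  "variety I = {x. \<forall>p\<in>I. meval x (complex_mpoly p) = 0}"

text \<open>Zero-dimensionality means that there are only finitely many complex zeros; the unit ideal
  is not excluded.\<close>

definition zero_dimensional :: "('n::finite, real) mpoly set \<Rightarrow> bool" where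
  "zero_dimensional I \<longleftrightarrow> finite (variety I)"

definition real_roots :: "('n::finite, real) mpoly set \<Rightarrow> (real ^ 'n) set" where
  "real_roots I = {x. (\<chi> i. complex_of_real (x $ i)) \<in> variety I}"

section \<open>Hermite matrices\<close>

text \<open>The quotient algebra modulo \<open>I\<close> is handled through congruence modulo \<open>I\<close>: \<open>monomial_basis I as\<close>
  says that the residue classes of the monomials with exponents in the list \<open>as\<close>
  form a basis of it as a real vector space (linear independence and spanning).\<close>

definition lin_comb :: "('n \<Rightarrow>\<^sub>0 nat) list \<Rightarrow> (nat \<Rightarrow> real) \<Rightarrow> ('n, real) mpoly" where
  "lin_comb as c = (\<Sum>j<length as. mmonom (as ! j) (c j))"

definition monomial_basis :: "('n, real) mpoly set \<Rightarrow> ('n \<Rightarrow>\<^sub>0 nat) list \<Rightarrow> bool" where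
  "monomial_basis I as \<longleftrightarrow>
     (\<forall>c. lin_comb as c \<in> I \<longrightarrow> (\<forall>j<length as. c j = 0)) \<and>
     (\<forall>p. \<exists>c. p - lin_comb as c \<in> I)"

text \<open>Coordinates of the residue class of \<open>p\<close>. For a monomial basis, the values at indices below
  \<^term>\<open>length as\<close> are uniquely determined; the other values are irrelevant.\<close>

definition coords :: "('n, real) mpoly set \<Rightarrow> ('n \<Rightarrow>\<^sub>0 nat) list \<Rightarrow> ('n, real) mpoly \<Rightarrow> nat \<Rightarrow> real" where
  "coords I as p = (SOME c. p - lin_comb as c \<in> I)"

text \<open>The matrix, in the given basis, of multiplication by \<open>p\<close> on the quotient algebra.\<close>

definition mult_matrix :: "('n, real) mpoly set \<Rightarrow> ('n \<Rightarrow>\<^sub>0 nat) list \<Rightarrow> ('n, real) mpoly \<Rightarrow> real mat" where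
  "mult_matrix I as p =
     mat (length as) (length as) (\<lambda>(i, j). coords I as (p * mmonom (as ! j) 1) i)"

definition mat_tr :: "'a::comm_monoid_add mat \<Rightarrow> 'a" where
  "mat_tr M = (\<Sum>i<dim_row M. M $$ (i, i))"

definition hermite_matrix :: "('n, real) mpoly set \<Rightarrow> ('n \<Rightarrow>\<^sub>0 nat) list \<Rightarrow> ('n, real) mpoly \<Rightarrow> real mat" where
  "hermite_matrix I as h =
     mat (length as) (length as)
       (\<lambda>(i, j). mat_tr (mult_matrix I as (h * mmonom (as ! i + as ! j) 1)))"

text \<open>Eigenvalues are counted with their multiplicity as roots of the characteristic polynomial.
  For a real symmetric matrix these are all the eigenvalues, and this multiplicity is
  the dimension of the eigenspace.\<close>

definition matrix_signature :: "real mat \<Rightarrow> int" where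
  "matrix_signature M =
     int (size {# l \<in># proots (char_poly M). l > 0 #}) -
     int (size {# l \<in># proots (char_poly M). l < 0 #})"

end

theory Submission
  imports Defs
begin

text \<open>Since \<open>I\<close> is radical and the quotient algebra is finite-dimensional, evaluation at the complex
  zeros identifies the complexified quotient algebra with the functions on the variety. In the basis
  of indicator functions multiplication by \<open>p\<close> is diagonal with entries \<open>p a\<close>, so
  the Hermite matrix is \<open>E\<^sup>T D E\<close> with \<open>E\<close> the invertible matrix of values of the basis monomials
  and \<open>D\<close> the diagonal matrix of values of \<open>h\<close>. A real zero contributes the sign
  of \<open>h\<close> to the signature and a pair of conjugate zeros contributes \<open>0\<close>, so
  \<open>\<sigma>(H\<^sub>h) = #{h > 0} - #{h < 0}\<close> over the real zeros. This equals \<open>\<sigma>(H\<^sub>1)\<close>, the number of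
  real zeros, precisely if \<open>h\<close> is positive at all of them.\<close>

text \<open>The entries of \<open>E\<close> are complex and its transpose carries no conjugation, so
  \<open>E\<^sup>T D E\<close> does not diagonalize the Hermitian form of the real matrix: the value
  at a point is paired with the value at the conjugate point. The signature is therefore not read
  off from a change of basis. The eigenvalue counts of each sign are bounded by numbers of linear
  forms, and the bounds are sharp because they add up to the dimension. Both these bounds and the
  existence of eigenvectors rest on one fact: a homogeneous linear system with fewer equations than
  unknowns has a nonzero solution. Radicality enters through the injectivity of evaluation, a
  Nullstellensatz that finite dimension reduces to common eigenvectors of the variables. The ball is
  closed because a root on its sphere is a zero of \<open>g\<close>: it contributes 0 to one
  signature and 1 to the other.\<close>

lemma mpoly_induct [case_names monom add]:
  fixes P :: "('k \<Rightarrow>\<^sub>0 'a::comm_monoid_add) \<Rightarrow> bool"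
  assumes monom: "\<And>\<alpha> c. P (Poly_Mapping.single \<alpha> c)"
    and add: "\<And>p q. P p \<Longrightarrow> P q \<Longrightarrow> P (p + q)"
  shows "P p"
proof (induction p rule: update_induct)
  case const
  \<comment> \<open>The zero polynomial is a monomial with coefficient 0, under any
    exponent.\<close>
  show ?case using monom[of undefined 0] by simp
next
  case (update f a b)
  have "Poly_Mapping.update a b f = Poly_Mapping.single a b + f"
  proof (rule poly_mapping_eqI)
    fix k
    show "Poly_Mapping.lookup (Poly_Mapping.update a b f) k
        = Poly_Mapping.lookup (Poly_Mapping.single a b + f) k"
      using update(1)
      by (auto simp: lookup_update lookup_add lookup_single when_def in_keys_iff)
  qed
  then show ?case using add[OF monom update(3)] by metis
qed

section \<open>Coefficientwise maps\<close>

lemma lookup_mpoly_map: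
  "h 0 = 0 \<Longrightarrow> Poly_Mapping.lookup (Poly_Mapping.map h p) \<alpha> = h (Poly_Mapping.lookup p \<alpha>)"
  by (simp add: Poly_Mapping.map.rep_eq when_def)

lemma mpoly_map_single:
  "h 0 = 0 \<Longrightarrow> Poly_Mapping.map h (Poly_Mapping.single \<alpha> c) = Poly_Mapping.single \<alpha> (h c)"
  by (rule poly_mapping_eqI) (simp add: lookup_mpoly_map lookup_single when_def)

lemma mpoly_map_add:
  assumes "h 0 = 0" "\<And>a b. h (a + b) = h a + h b"
  shows "Poly_Mapping.map h (p + q) = Poly_Mapping.map h p + Poly_Mapping.map h q"
  by (rule poly_mapping_eqI) (simp add: lookup_mpoly_map lookup_add assms)

lemma mpoly_map_comm_ring_hom:
  fixes h :: "'a::comm_ring_1 \<Rightarrow> 'b::comm_ring_1"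
  assumes "comm_ring_hom h"
  shows "comm_ring_hom (Poly_Mapping.map h :: ('k::comm_monoid_add \<Rightarrow>\<^sub>0 'a) \<Rightarrow> _)"
proof -
  interpret h: comm_ring_hom h by fact
  have add: "Poly_Mapping.map h (p + q) = Poly_Mapping.map h p + Poly_Mapping.map h q"
    for p q :: "'k \<Rightarrow>\<^sub>0 'a"
    by (rule mpoly_map_add) (simp_all add: h.hom_add)
  have mult: "Poly_Mapping.map h (p * q) = Poly_Mapping.map h p * Poly_Mapping.map h q"
    for p q :: "'k \<Rightarrow>\<^sub>0 'a"
  proof (induction p rule: mpoly_induct)
    case (monom \<alpha> c)
    show ?case
    proof (induction q rule: mpoly_induct)
      case (monom \<beta> d)
      show ?case by (simp add: mult_single mpoly_map_single h.hom_mult)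
    qed (simp add: distrib_left add)
  qed (simp add: distrib_right add)
  show ?thesis
  proof
    show "Poly_Mapping.map h (1 :: 'k \<Rightarrow>\<^sub>0 'a) = 1"
      using mpoly_map_single[of h "0::'k" 1] by simp
    show "Poly_Mapping.map h (0 :: 'k \<Rightarrow>\<^sub>0 'a) = 0"
      using mpoly_map_single[of h "0::'k" 0] by simp
  qed (fact add mult)+
qed

interpretation mconst: comm_ring_hom "mconst :: 'a::comm_ring_1 \<Rightarrow> ('n, 'a) mpoly"
  by unfold_locales
    (simp_all add: mconst_def mmonom_def single_add mult_single)

interpretation real_mpoly: comm_ring_hom "real_mpoly :: ('n, rat) mpoly \<Rightarrow> _"
  unfolding real_mpoly_def
  by (rule mpoly_map_comm_ring_hom) (unfold_locales, simp_all add: of_rat_add of_rat_mult)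

interpretation complex_mpoly: comm_ring_hom "complex_mpoly :: ('n, real) mpoly \<Rightarrow> _"
  unfolding complex_mpoly_def
  by (rule mpoly_map_comm_ring_hom) (unfold_locales, simp_all)

lemma complex_mpoly_mmonom [simp]: "complex_mpoly (mmonom \<alpha> c) = mmonom \<alpha> (of_real c)"
  by (simp add: complex_mpoly_def mmonom_def mpoly_map_single)

lemma complex_mpoly_mconst [simp]: "complex_mpoly (mconst c) = mconst (of_real c)"
  by (simp add: mconst_def)

lemma complex_mpoly_mvar [simp]: "complex_mpoly (mvar i) = mvar i"
  by (simp add: mvar_def)

lemma real_mpoly_mconst [simp]: "real_mpoly (mconst c) = mconst (of_rat c)"
  by (simp add: mconst_def real_mpoly_def mmonom_def mpoly_map_single)

lemma real_mpoly_mvar [simp]: "real_mpoly (mvar i) = mvar i"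
  by (simp add: mvar_def real_mpoly_def mmonom_def mpoly_map_single)

section \<open>Evaluation\<close>

lemma meval_mmonom: "meval x (mmonom \<alpha> c) = c * (\<Prod>i\<in>UNIV. (x $ i) ^ Poly_Mapping.lookup \<alpha> i)"
  by (simp add: meval_def mmonom_def)

lemma meval_add: "meval x (p + q) = meval x p + meval x q"
  unfolding meval_def
  by (rule setsum_keys_plus_distrib) (simp_all add: distrib_right)

lemma meval_mult:
  fixes x :: "'a::comm_ring_1 ^ 'n"
  shows "meval x (p * q) = meval x p * meval x q"
proof (induction p rule: mpoly_induct)
  case (monom \<alpha> c)
  show ?case
  proof (induction q rule: mpoly_induct)
    case (monom \<beta> d)
    show ?case
      using meval_mmonom[of x \<alpha> c] meval_mmonom[of x \<beta> d] meval_mmonom[of x "\<alpha> + \<beta>" "c * d"]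
      by (simp add: mmonom_def mult_single lookup_add power_add prod.distrib)
  qed (simp add: distrib_left meval_add)
qed (simp add: distrib_right meval_add)

lemma meval_mconst [simp]: "meval x (mconst c) = c"
  by (simp add: mconst_def meval_mmonom)

lemma meval_mvar [simp]: "meval x (mvar i) = x $ i"
proof -
  have "(\<Prod>j\<in>UNIV. (x $ j) ^ (1 when i = j)) = (\<Prod>j\<in>UNIV. if i = j then x $ j else 1)"
    by (rule prod.cong) (auto simp: when_def)
  then show ?thesis by (simp add: mvar_def meval_mmonom lookup_single)
qed

interpretation meval: comm_ring_hom "meval x" for x :: "'a::comm_ring_1 ^ 'n::finite"
  using meval_mconst[of x 0] meval_mconst[of x 1]
  by unfold_locales (simp_all add: meval_add meval_mult del: meval_mconst)

lemma mconst_mult_mmonom: "mconst c * mmonom \<alpha> d = mmonom \<alpha> (c * d)"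
  by (simp add: mconst_def mmonom_def mult_single)

lemma mmonom_sum: "mmonom \<alpha> (sum f S) = (\<Sum>j\<in>S. mmonom \<alpha> (f j))"
  by (induction S rule: infinite_finite_induct) (simp_all add: mmonom_def single_add)

lemma meval_cnj:
  "meval (\<chi> i. cnj (x $ i)) (complex_mpoly p) = cnj (meval x (complex_mpoly p))"
proof (induction p rule: mpoly_induct)
  case (monom \<alpha> c)
  show ?case by (simp add: meval_mmonom flip: mmonom_def)
qed (simp add: complex_mpoly.hom_add meval_add)

text \<open>Suits properties that respect the ring operations, such as acting on a common
  eigenvector by the value at a point. A monomial is rebuilt as a constant times powers of
  variables.\<close>

lemma mpoly_ring_induct [case_names const var add mult]:
  fixes P :: "('n::finite, 'a::comm_ring_1) mpoly \<Rightarrow> bool"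
  assumes const: "\<And>c. P (mconst c)" and var: "\<And>i. P (mvar i)"
    and add: "\<And>p q. P p \<Longrightarrow> P q \<Longrightarrow> P (p + q)" and mult: "\<And>p q. P p \<Longrightarrow> P q \<Longrightarrow> P (p * q)"
  shows "P p"
proof (induction p rule: mpoly_induct)
  case (monom \<alpha> c)
  have one: "P 1" using const[of 1] by simp
  have pow: "P (mvar i ^ k)" for i k by (induction k) (simp_all add: one var mult)
  have power: "mvar i ^ k = Poly_Mapping.single (Poly_Mapping.single i k) (1::'a)" for i :: 'n and k
    by (induction k) (simp_all add: mvar_def mmonom_def mult_single single_add[symmetric])
  have prod: "(\<Prod>i\<in>F. Poly_Mapping.single (\<beta> i) (1::'a)) = Poly_Mapping.single (\<Sum>i\<in>F. \<beta> i) 1"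
    if "finite F" for F and \<beta> :: "'n \<Rightarrow> 'n \<Rightarrow>\<^sub>0 nat"
    using that by induction (simp_all add: mult_single)
  have "(\<Sum>i\<in>UNIV. Poly_Mapping.single i (Poly_Mapping.lookup \<alpha> i)) = \<alpha>"
    by (rule poly_mapping_eqI) (simp add: lookup_sum lookup_single when_def)
  then have "(\<Prod>i\<in>UNIV. mvar i ^ Poly_Mapping.lookup \<alpha> i) = Poly_Mapping.single \<alpha> (1::'a)"
    by (simp add: power prod)
  then have "Poly_Mapping.single \<alpha> c = mconst c * (\<Prod>i\<in>UNIV. mvar i ^ Poly_Mapping.lookup \<alpha> i)"
    by (simp add: mconst_def mmonom_def mult_single)
  moreover have "P (\<Prod>i\<in>F. mvar i ^ Poly_Mapping.lookup \<alpha> i)" if "finite F" for F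
    using that by induction (simp_all add: one mult pow)
  ultimately show ?case using mult const by simp
qed (fact add)

section \<open>Linear algebra\<close>

text \<open>Padding with zero rows gives a square matrix whose last row is zero, as
  \<open>m < n\<close>; its determinant vanishes, so it has a nonzero kernel vector.\<close>

lemma homogeneous_system_nat:
  fixes c :: "nat \<Rightarrow> nat \<Rightarrow> 'a::field"
  assumes "m < n"
  shows "\<exists>y. (\<exists>j<n. y j \<noteq> 0) \<and> (\<forall>i<m. (\<Sum>j<n. c i j * y j) = 0)"
proof -
  define A where "A = mat n n (\<lambda>(i, j). if i < m then c i j else 0)"
  have A: "A \<in> carrier_mat n n" by (simp add: A_def)
  have "A = mat\<^sub>r n n (\<lambda>i. if i = n - 1 then 0\<^sub>v n else row A i)"
    using assms by (intro eq_matI) (auto simp: A_def)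
  then have "det A = 0" using det_row_0[of "n - 1" n "row A"] A assms by fastforce
  then obtain v where v: "v \<in> carrier_vec n" "v \<noteq> 0\<^sub>v n" "A *\<^sub>v v = 0\<^sub>v n"
    using det_0_iff_vec_prod_zero_field[OF A] by blast
  have "\<exists>j<n. vec_index v j \<noteq> 0" using v(1,2) by (metis carrier_vecD eq_vecI index_zero_vec)
  moreover have "(\<Sum>j<n. c i j * vec_index v j) = 0" if i: "i < m" for i
  proof -
    have "vec_index (A *\<^sub>v v) i = 0" using v(3) i assms by simp
    moreover have "vec_index (A *\<^sub>v v) i = (\<Sum>j<n. c i j * vec_index v j)"
      using i assms v(1) by (simp add: A_def scalar_prod_def atLeast0LessThan)
    ultimately show ?thesis by simp
  qed
  ultimately show ?thesis by blast
qed

lemma homogeneous_system: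
  fixes c :: "'s \<Rightarrow> 't \<Rightarrow> 'a::field"
  assumes "finite S" "finite T" "card S < card T"
  obtains y where "\<exists>j\<in>T. y j \<noteq> 0" "\<And>i. i \<in> S \<Longrightarrow> (\<Sum>j\<in>T. c i j * y j) = 0"
proof -
  obtain e where e: "bij_betw e {0..<card S} S" using ex_bij_betw_nat_finite[OF assms(1)] by blast
  obtain f where f: "bij_betw f {0..<card T} T" using ex_bij_betw_nat_finite[OF assms(2)] by blast
  obtain y where y: "\<exists>j<card T. y j \<noteq> 0"
      "\<forall>i<card S. (\<Sum>j<card T. c (e i) (f j) * y j) = 0"
    using homogeneous_system_nat[OF assms(3), of "\<lambda>i j. c (e i) (f j)"] by blast
  define g where "g = the_inv_into {0..<card T} f"
  have gf: "g (f j) = j" if "j < card T" for j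
    using that f by (simp add: g_def the_inv_into_f_f bij_betw_def)
  have "(\<Sum>j\<in>T. c (e i) j * y (g j)) = (\<Sum>j<card T. c (e i) (f j) * y j)" for i
    by (subst sum.reindex_bij_betw[OF f, symmetric]) (simp add: gf atLeast0LessThan)
  then have "(\<Sum>j\<in>T. c i j * y (g j)) = 0" if "i \<in> e ` {0..<card S}" for i
    using that y(2) by auto
  then have "(\<Sum>j\<in>T. c i j * y (g j)) = 0" if "i \<in> S" for i
    using that bij_betw_imp_surj_on[OF e] by simp
  moreover have "\<exists>j\<in>T. y (g j) \<noteq> 0"
    using y(1) f gf by (metis atLeastLessThan_iff bij_betwE zero_le)
  ultimately show ?thesis using that[of "\<lambda>j. y (g j)"] by blast
qed

text \<open>With \<open>K\<close> the annihilator of a vector \<open>w\<close> under an operator \<open>T\<close>, the vector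
  \<open>r(T) w\<close> is an eigenvector. This is applied to matrices and to quotients of polynomial rings.\<close>

lemma annihilator_imp_eigen:
  fixes K :: "complex poly set"
  assumes "q \<in> K" "q \<noteq> 0" "\<And>c. c \<noteq> 0 \<Longrightarrow> [:c:] \<notin> K"
  obtains a r where "r \<notin> K" "[:-a, 1:] * r \<in> K"
proof -
  have "\<exists>a r. r \<notin> K \<and> [:-a, 1:] * r \<in> K"
    \<comment> \<open>Split off a root of \<open>q\<close>. Either the cofactor lies outside
      \<open>K\<close>, or it is a nonzero element of \<open>K\<close> of smaller degree; the
      descent cannot reach a constant.\<close>
    using assms(1,2)
  proof (induction "degree q" arbitrary: q)
    case 0
    then show ?case using assms(3) by (metis degree_eq_zeroE pCons_0_0)
  next
    case (Suc d)
    then have "\<not> constant (poly q)" by (simp add: constant_degree)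
    then obtain a where "poly q a = 0" using fundamental_theorem_of_algebra by blast
    then obtain r where r: "q = [:-a, 1:] * r" by (auto simp: poly_eq_0_iff_dvd dvd_def)
    have "r \<noteq> 0" using Suc(4) r by auto
    then have "degree q = Suc (degree r)" unfolding r by (subst degree_mult_eq) auto
    then show ?case using Suc r \<open>r \<noteq> 0\<close> by (metis diff_Suc_1)
  qed
  then show ?thesis using that by blast
qed

section \<open>The spectral theorem for real symmetric matrices\<close>

text \<open>The vectors are complex because they come from a root of a complex polynomial; only the
  eigenvalues are required to be real. Normalization is left to
  \<open>symmetric_spectral\<close>.\<close>

definition orthogonal_eigenvectors ::
  "nat \<Rightarrow> (nat \<Rightarrow> nat \<Rightarrow> real) \<Rightarrow> nat \<Rightarrow> (nat \<Rightarrow> real) \<Rightarrow> (nat \<Rightarrow> nat \<Rightarrow> complex) \<Rightarrow> bool" where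
  "orthogonal_eigenvectors k M d l v \<longleftrightarrow> (\<forall>i<d. (\<exists>r<k. v i r \<noteq> 0)
     \<and> (\<forall>r<k. (\<Sum>s<k. of_real (M r s) * v i s) = of_real (l i) * v i r)
     \<and> (\<forall>j<d. j \<noteq> i \<longrightarrow> (\<Sum>r<k. v i r * cnj (v j r)) = 0))"

text \<open>A vector orthogonal to the eigenvectors found so far spans, together with its images
  under the matrix, a space that contains an eigenvector orthogonal to all of them.\<close>

lemma symmetric_orthogonal_eigenvectors:
  fixes M :: "nat \<Rightarrow> nat \<Rightarrow> real"
  assumes sym: "\<And>r s. r < k \<Longrightarrow> s < k \<Longrightarrow> M r s = M s r" and "d \<le> k"
  shows "\<exists>l v. orthogonal_eigenvectors k M d l v"
  using \<open>d \<le> k\<close>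
proof (induction d)
  case 0
  show ?case unfolding orthogonal_eigenvectors_def by simp
next
  case (Suc d)
  then obtain l v where lv: "orthogonal_eigenvectors k M d l v" by auto
  have nz: "\<exists>r<k. v i r \<noteq> 0" if "i < d" for i
    using lv that by (simp add: orthogonal_eigenvectors_def)
  have eig: "(\<Sum>s<k. of_real (M r s) * v i s) = of_real (l i) * v i r" if "i < d" "r < k" for i r
    using lv that by (simp add: orthogonal_eigenvectors_def)
  have orth: "(\<Sum>r<k. v i r * cnj (v j r)) = 0" if "i < d" "j < d" "j \<noteq> i" for i j
    using lv that by (simp add: orthogonal_eigenvectors_def)
  define T where "T w r = (\<Sum>s<k. complex_of_real (M r s) * w s)" for w r
  \<comment> \<open>Self-adjointness keeps the iterates orthogonal to the earlier eigenvectors and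
    later makes the new eigenvalue real.\<close>
  have adj: "(\<Sum>r<k. T w r * cnj (u r)) = (\<Sum>r<k. w r * cnj (T u r))" for w u
  proof -
    have "(\<Sum>r<k. T w r * cnj (u r)) = (\<Sum>r<k. \<Sum>s<k. of_real (M r s) * w s * cnj (u r))"
      by (simp add: T_def sum_distrib_right)
    also have "\<dots> = (\<Sum>s<k. \<Sum>r<k. of_real (M r s) * w s * cnj (u r))"
      by (rule sum.swap)
    also have "\<dots> = (\<Sum>s<k. w s * cnj (T u s))"
      using sym by (auto simp: T_def sum_distrib_left intro!: sum.cong)
    finally show ?thesis .
  qed
  obtain w where w: "\<exists>j\<in>{..<k}. w j \<noteq> 0" "\<And>i. i \<in> {..<d} \<Longrightarrow> (\<Sum>j<k. cnj (v i j) * w j) = 0"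
    using homogeneous_system[of "{..<d}" "{..<k}" "\<lambda>i j. cnj (v i j)"] Suc(2) by auto
  define x where "x j = (T ^^ j) w" for j
  have x0: "x 0 = w" and xS: "x (Suc j) r = T (x j) r" for j r by (simp_all add: x_def)
  have x_orth: "(\<Sum>r<k. x j r * cnj (v i r)) = 0" if "i < d" for i j
  proof (induction j)
    case 0
    show ?case using w(2) that by (simp add: x0 mult.commute)
  next
    case (Suc j)
    have "(\<Sum>r<k. x (Suc j) r * cnj (v i r)) = (\<Sum>r<k. x j r * cnj (T (v i) r))"
      by (simp add: xS adj)
    also have "\<dots> = (\<Sum>r<k. of_real (l i) * (x j r * cnj (v i r)))"
      using eig[OF that] by (intro sum.cong) (auto simp: T_def)
    also have "\<dots> = 0" using Suc by (simp flip: sum_distrib_left)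
    finally show ?case .
  qed
  \<comment> \<open>\<open>ev p\<close> is the vector p(T) w. The next fact allows any range beyond
    the degree, so that sums for different polynomials can be compared.\<close>
  define ev where "ev p r = (\<Sum>j\<le>degree p. coeff p j * x j r)" for p r
  have ev: "ev p r = (\<Sum>j\<le>N. coeff p j * x j r)" if "degree p \<le> N" for p r N
    unfolding ev_def using that
    by (intro sum.mono_neutral_left) (auto intro: le_degree)
  \<comment> \<open>The \<open>k + 1\<close> iterates have \<open>k\<close> components each, hence
    are dependent; the dependence becomes an annihilating polynomial \<open>q\<close>.\<close>
  obtain c where c: "\<exists>j\<in>{..k}. c j \<noteq> 0" "\<And>r. r \<in> {..<k} \<Longrightarrow> (\<Sum>j\<le>k. x j r * c j) = 0"
    using homogeneous_system[of "{..<k}" "{..k}" "\<lambda>r j. x j r"] by auto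
  define q where "q = (\<Sum>j\<le>k. monom (c j) j)"
  have cq: "coeff q j = (if j \<le> k then c j else 0)" for j
    by (simp add: q_def coeff_sum)
  have dq: "degree q \<le> k" by (rule degree_le) (simp add: cq)
  have T_ev: "ev ([:-a, 1:] * p) r = T (ev p) r - a * ev p r" for a p r
  proof -
    let ?N = "degree p"
    have "ev ([:-a, 1:] * p) r = (\<Sum>j\<le>Suc ?N. coeff ([:-a, 1:] * p) j * x j r)"
      by (rule ev) (use degree_mult_le[of "[:-a, 1:]" p] in auto)
    also have "\<dots> = (\<Sum>j\<le>Suc ?N. coeff (pCons 0 p) j * x j r) - (\<Sum>j\<le>Suc ?N. a * (coeff p j * x j r))"
      by (subst sum_subtractf[symmetric], rule sum.cong) (simp_all add: algebra_simps)
    also have "(\<Sum>j\<le>Suc ?N. a * (coeff p j * x j r)) = a * ev p r"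
      by (subst ev[of p "Suc ?N"]) (simp_all add: sum_distrib_left distrib_left)
    also have "(\<Sum>j\<le>Suc ?N. coeff (pCons 0 p) j * x j r) = (\<Sum>j\<le>?N. coeff p j * T (x j) r)"
      by (subst sum.atMost_Suc_shift) (simp add: xS)
    also have "\<dots> = (\<Sum>j\<le>?N. \<Sum>s<k. of_real (M r s) * (coeff p j * x j s))"
      by (simp add: T_def sum_distrib_left mult.left_commute)
    also have "\<dots> = T (ev p) r"
      unfolding T_def ev_def sum_distrib_left by (rule sum.swap)
    finally show ?thesis .
  qed
  define K where "K = {p. \<forall>r<k. ev p r = 0}"
  have "q \<in> K"
    using c(2) by (auto simp: K_def ev[OF dq] cq mult.commute)
  moreover have "q \<noteq> 0" using c(1) cq by (metis atMost_iff coeff_0)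
  moreover have "[:a:] \<notin> K" if "a \<noteq> 0" for a
    using w(1) that by (auto simp: K_def ev_def x0)
  ultimately obtain a p where p: "p \<notin> K" "[:-a, 1:] * p \<in> K"
    by (rule annihilator_imp_eigen)
  define u where "u = ev p"
  have u_nz: "\<exists>r<k. u r \<noteq> 0" using p(1) by (auto simp: K_def u_def)
  have u_eig: "T u r = a * u r" if "r < k" for r
    using p(2) that T_ev[of a p r] by (simp add: K_def u_def del: mult_pCons_left)
  have u_orth: "(\<Sum>r<k. u r * cnj (v i r)) = 0" if "i < d" for i
  proof -
    have "(\<Sum>r<k. u r * cnj (v i r)) = (\<Sum>j\<le>degree p. coeff p j * (\<Sum>r<k. x j r * cnj (v i r)))"
      unfolding u_def ev_def sum_distrib_right sum_distrib_left
      by (subst sum.swap) (simp add: mult.assoc)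
    then show ?thesis using x_orth[OF that] by simp
  qed
  have u_orth': "(\<Sum>r<k. v i r * cnj (u r)) = 0" if "i < d" for i
    using arg_cong[OF u_orth[OF that], of cnj] by (simp add: mult.commute)
  have sq: "u r * cnj (u r) = of_real ((cmod (u r))\<^sup>2)" for r
    by (rule complex_norm_square[symmetric])
  have "(\<Sum>r<k. (cmod (u r))\<^sup>2) \<noteq> 0"
    using u_nz by (auto simp: sum_nonneg_eq_0_iff)
  moreover have "(\<Sum>r<k. u r * cnj (u r)) = of_real (\<Sum>r<k. (cmod (u r))\<^sup>2)"
    by (simp only: sq of_real_sum)
  ultimately have "(\<Sum>r<k. u r * cnj (u r)) \<noteq> 0" by (metis of_real_eq_0_iff)
  moreover have "a * (\<Sum>r<k. u r * cnj (u r)) = cnj a * (\<Sum>r<k. u r * cnj (u r))"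
  proof -
    have "a * (\<Sum>r<k. u r * cnj (u r)) = (\<Sum>r<k. T u r * cnj (u r))"
      by (simp add: sum_distrib_left u_eig mult.assoc)
    also have "\<dots> = (\<Sum>r<k. u r * cnj (T u r))" by (rule adj)
    also have "\<dots> = cnj a * (\<Sum>r<k. u r * cnj (u r))"
      by (simp add: u_eig sum_distrib_left mult.left_commute)
    finally show ?thesis .
  qed
  ultimately have "a = cnj a" by simp
  then have a: "a = of_real (Re a)" by (metis Reals_cnj_iff of_real_Re)
  show ?case
    unfolding orthogonal_eigenvectors_def
  proof (rule exI[of _ "l(d := Re a)"], rule exI[of _ "v(d := u)"], intro allI impI conjI)
    fix i assume i: "i < Suc d"
    show "\<exists>r<k. (v(d := u)) i r \<noteq> 0" using nz u_nz i by (auto simp: less_Suc_eq)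
    show "(\<Sum>s<k. of_real (M r s) * (v(d := u)) i s) = of_real ((l(d := Re a)) i) * (v(d := u)) i r"
      if "r < k" for r
      using eig u_eig that i a by (auto simp: less_Suc_eq T_def)
    show "(\<Sum>r<k. (v(d := u)) i r * cnj ((v(d := u)) j r)) = 0" if "j < Suc d" "j \<noteq> i" for j
      using that i orth u_orth u_orth' by (auto simp: less_Suc_eq)
  qed
qed

text \<open>Unit eigenvectors form the columns of \<open>P\<close> and their conjugates the rows of
  \<open>Q\<close>, so orthonormality says \<open>Q * P = 1\<close> and the matrix is similar, over
  the complex numbers, to the diagonal matrix of its eigenvalues.\<close>

theorem symmetric_spectral:
  fixes M :: "real mat"
  assumes M: "M \<in> carrier_mat k k" and sym: "\<And>r s. r < k \<Longrightarrow> s < k \<Longrightarrow> M $$ (r, s) = M $$ (s, r)"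
  obtains l :: "nat \<Rightarrow> real" and v :: "nat \<Rightarrow> nat \<Rightarrow> complex" where
    "char_poly M = (\<Prod>i<k. [:- l i, 1:])"
    "\<forall>i<k. \<forall>r<k. (\<Sum>s<k. of_real (M $$ (r, s)) * v i s) = of_real (l i) * v i r"
    "\<forall>i<k. \<forall>j<k. (\<Sum>r<k. v i r * cnj (v j r)) = (if i = j then 1 else 0)"
proof -
  obtain l u where lu: "orthogonal_eigenvectors k (\<lambda>r s. M $$ (r, s)) k l u"
    using symmetric_orthogonal_eigenvectors[of k "\<lambda>r s. M $$ (r, s)" k] sym by auto
  have nz: "\<exists>r<k. u i r \<noteq> 0" if "i < k" for i
    using lu that by (simp add: orthogonal_eigenvectors_def)
  have eig_u: "(\<Sum>s<k. of_real (M $$ (r, s)) * u i s) = of_real (l i) * u i r" if "i < k" "r < k" for i r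
    using lu that by (simp add: orthogonal_eigenvectors_def)
  have orth_u: "(\<Sum>r<k. u i r * cnj (u j r)) = 0" if "i < k" "j < k" "j \<noteq> i" for i j
    using lu that by (simp add: orthogonal_eigenvectors_def)
  define N where "N i = sqrt (\<Sum>r<k. (cmod (u i r))\<^sup>2)" for i
  define v where "v i r = u i r / of_real (N i)" for i r
  have eig: "(\<Sum>s<k. of_real (M $$ (r, s)) * v i s) = of_real (l i) * v i r" if "i < k" "r < k" for i r
    using eig_u[OF that] by (simp add: v_def flip: sum_divide_distrib)
  have sq: "z * cnj z = of_real ((cmod z)\<^sup>2)" for z
    by (rule complex_norm_square[symmetric])
  have unit: "(\<Sum>r<k. v i r * cnj (v i r)) = 1" if "i < k" for i
  proof -
    have pos: "(\<Sum>r<k. (cmod (u i r))\<^sup>2) > 0"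
    proof -
      obtain r where "r < k" "u i r \<noteq> 0" using nz[OF \<open>i < k\<close>] by blast
      then show ?thesis by (intro sum_pos2[of "{..<k}" r]) auto
    qed
    then have "N i * N i = (\<Sum>r<k. (cmod (u i r))\<^sup>2)" by (simp add: N_def)
    then have N2: "of_real (N i) * of_real (N i) = (\<Sum>r<k. u i r * cnj (u i r))"
      by (simp only: sq flip: of_real_mult of_real_sum)
    have "(\<Sum>r<k. v i r * cnj (v i r)) = (\<Sum>r<k. u i r * cnj (u i r)) / (of_real (N i) * of_real (N i))"
      by (simp add: v_def sum_divide_distrib)
    then show ?thesis using pos by (simp add: N2[symmetric] N_def)
  qed
  have orth: "(\<Sum>r<k. v i r * cnj (v j r)) = (if i = j then 1 else 0)" if "i < k" "j < k" for i j
  proof (cases "i = j")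
    case False
    then show ?thesis using orth_u[of i j] that
      by (simp add: v_def flip: sum_divide_distrib)
  qed (use unit that in simp)
  define C where "C = map_mat complex_of_real M"
  define P where "P = mat k k (\<lambda>(r, i). v i r)"
  define Q where "Q = mat k k (\<lambda>(i, r). cnj (v i r))"
  define D where "D = mat k k (\<lambda>(i, j). if i = j then complex_of_real (l i) else 0)"
  have carr: "C \<in> carrier_mat k k" "P \<in> carrier_mat k k" "Q \<in> carrier_mat k k" "D \<in> carrier_mat k k"
    using M by (auto simp: C_def P_def Q_def D_def)
  have QP: "Q * P = 1\<^sub>m k"
    by (rule eq_matI) (use orth in \<open>auto simp: Q_def P_def scalar_prod_def atLeast0LessThan mult.commute\<close>)
  have PQ: "P * Q = 1\<^sub>m k" using mat_mult_left_right_inverse carr QP by blast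
  have CP: "C * P = P * D"
  proof (rule eq_matI)
    fix r i assume "r < dim_row (P * D)" "i < dim_col (P * D)"
    then have ri: "r < k" "i < k" using carr by auto
    have "(C * P) $$ (r, i) = (\<Sum>s<k. of_real (M $$ (r, s)) * v i s)"
      using ri carr M by (simp add: C_def P_def scalar_prod_def atLeast0LessThan)
    also have "\<dots> = of_real (l i) * v i r" using eig ri by simp
    also have "\<dots> = (P * D) $$ (r, i)"
      using ri by (simp add: P_def D_def scalar_prod_def atLeast0LessThan if_distrib mult.commute cong: if_cong)
    finally show "(C * P) $$ (r, i) = (P * D) $$ (r, i)" .
  qed (use carr in auto)
  have "C = C * (P * Q)" using carr PQ by simp
  also have "\<dots> = P * D * Q" using carr CP by (metis assoc_mult_mat)
  finally have "similar_mat_wit C D P Q"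
    unfolding similar_mat_wit_def using carr PQ QP by (simp add: Let_def)
  then have "similar_mat C D" unfolding similar_mat_def by blast
  then have "char_poly C = char_poly D" by (rule char_poly_similar)
  also have "\<dots> = (\<Prod>a\<leftarrow>diag_mat D. [:- a, 1:])"
    by (rule char_poly_upper_triangular[OF carr(4)]) (auto simp: D_def)
  also have "\<dots> = prod_list (map (\<lambda>i. [:- complex_of_real (l i), 1:]) [0..<k])"
    by (auto simp: diag_mat_def D_def intro!: arg_cong[of _ _ prod_list])
  also have "\<dots> = (\<Prod>i<k. [:- complex_of_real (l i), 1:])"
    by (subst prod.distinct_set_conv_list[symmetric]) (simp_all add: atLeast0LessThan)
  finally have hc: "map_poly of_real (char_poly M) = (\<Prod>i<k. [:- complex_of_real (l i), 1:])"
    by (simp add: C_def of_real_hom.char_poly_hom[OF M])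
  \<comment> \<open>Both sides come from real polynomials, and the coefficientwise embedding is
    injective, so the factorization descends to the reals.\<close>
  interpret h: map_poly_inj_comm_ring_hom "of_real :: real \<Rightarrow> complex" ..
  note hc
  also have "(\<Prod>i<k. [:- complex_of_real (l i), 1:]) = map_poly of_real (\<Prod>i<k. [:- l i, 1:])"
    by (simp add: h.hom_prod)
  finally have "char_poly M = (\<Prod>i<k. [:- l i, 1:])" by (simp only: h.eq_iff)
  then show ?thesis using that eig orth by blast
qed

section \<open>Signature and inertia\<close>

lemma signature_of_roots:
  fixes k :: nat
  assumes "char_poly M = (\<Prod>i<k. [:- l i, 1:])"
  shows "matrix_signature M = int (card {i. i < k \<and> l i > 0}) - int (card {i. i < k \<and> l i < 0})"
proof -
  have "proots (char_poly M) = (\<Sum>i<k. {# l i #})"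
    unfolding assms by (subst proots_prod) auto
  also have "\<dots> = image_mset l (mset_set {..<k})"
    by (induction k) (simp_all add: lessThan_Suc)
  finally have "size {# t \<in># proots (char_poly M). Q t #} = card {i. i < k \<and> Q (l i)}" for Q
    by (simp add: filter_mset_image_mset Collect_conj_eq lessThan_def)
  then show ?thesis by (simp add: matrix_signature_def)
qed

text \<open>The hypotheses bound the numbers of positive, negative and zero eigenvalues by the numbers of
  linear forms in \<open>P\<close>, \<open>N\<close> and \<open>Z\<close>. All three bounds are attained, since both
  sides sum to \<open>k\<close>.\<close>

theorem signature_by_inertia:
  fixes M :: "real mat" and p n z :: "'i \<Rightarrow> nat \<Rightarrow> complex"
  assumes M: "M \<in> carrier_mat k k" and sym: "\<And>r s. r < k \<Longrightarrow> s < k \<Longrightarrow> M $$ (r, s) = M $$ (s, r)"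
    and fin: "finite P" "finite N" "finite Z" and card: "card P + card N + card Z = k"
    and pos: "\<And>u. (\<And>i. i \<in> P \<Longrightarrow> (\<Sum>r<k. p i r * u r) = 0) \<Longrightarrow>
                Re (\<Sum>r<k. \<Sum>s<k. cnj (u r) * of_real (M $$ (r, s)) * u s) \<le> 0"
    and neg: "\<And>u. (\<And>i. i \<in> N \<Longrightarrow> (\<Sum>r<k. n i r * u r) = 0) \<Longrightarrow>
                Re (\<Sum>r<k. \<Sum>s<k. cnj (u r) * of_real (M $$ (r, s)) * u s) \<ge> 0"
    and null: "\<And>u r. (\<And>r. r < k \<Longrightarrow> (\<Sum>s<k. of_real (M $$ (r, s)) * u s) = 0) \<Longrightarrow>
                (\<And>i. i \<in> Z \<Longrightarrow> (\<Sum>r<k. z i r * u r) = 0) \<Longrightarrow> r < k \<Longrightarrow> u r = 0"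
  shows "matrix_signature M = int (card P) - int (card N)"
proof -
  obtain l :: "nat \<Rightarrow> real" and v :: "nat \<Rightarrow> nat \<Rightarrow> complex" where
    char: "char_poly M = (\<Prod>i<k. [:- l i, 1:])" and
    "\<forall>i<k. \<forall>r<k. (\<Sum>s<k. of_real (M $$ (r, s)) * v i s) = of_real (l i) * v i r" and
    "\<forall>i<k. \<forall>j<k. (\<Sum>r<k. v i r * cnj (v j r)) = (if i = j then 1 else 0)"
    using symmetric_spectral[OF M sym] .
  then have eig: "(\<Sum>s<k. of_real (M $$ (r, s)) * v i s) = of_real (l i) * v i r" if "i < k" "r < k" for i r
    using that by blast
  have orth: "(\<Sum>r<k. v i r * cnj (v j r)) = (if i = j then 1 else 0)" if "i < k" "j < k" for i j
    using that \<open>\<forall>i<k. \<forall>j<k. _ = (if i = j then 1 else 0)\<close> by blast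
  \<comment> \<open>With fewer forms in \<open>C\<close> than indices in \<open>T\<close>, some
    nonzero combination of the eigenvectors is killed by all the forms; orthonormality evaluates the
    Hermitian form on it.\<close>
  have combination: "\<exists>y u. (\<exists>i\<in>T. y i \<noteq> 0) \<and> (\<exists>r\<in>{..<k}. u r \<noteq> 0)
      \<and> (\<forall>i\<in>C. (\<Sum>r<k. c i r * u r) = 0)
      \<and> (\<forall>r<k. (\<Sum>s<k. of_real (M $$ (r, s)) * u s) = (\<Sum>i\<in>T. of_real (l i) * (y i * v i r)))
      \<and> Re (\<Sum>r<k. \<Sum>s<k. cnj (u r) * of_real (M $$ (r, s)) * u s) = (\<Sum>i\<in>T. l i * (cmod (y i))\<^sup>2)"
    if T: "T \<subseteq> {..<k}" and C: "finite C" "card C < card T" for C T and c :: "'i \<Rightarrow> nat \<Rightarrow> complex"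
  proof -
    have finT: "finite T" using T finite_subset by blast
    obtain y where y: "\<exists>i\<in>T. y i \<noteq> 0" "\<And>i. i \<in> C \<Longrightarrow> (\<Sum>j\<in>T. (\<Sum>r<k. c i r * v j r) * y j) = 0"
      by (rule homogeneous_system[OF C(1) finT C(2), of "\<lambda>i j. \<Sum>r<k. c i r * v j r"]) blast
    define u where "u r = (\<Sum>i\<in>T. y i * v i r)" for r
    have cu: "(\<Sum>r<k. c i r * u r) = 0" if "i \<in> C" for i
    proof -
      have "(\<Sum>r<k. c i r * u r) = (\<Sum>j\<in>T. (\<Sum>r<k. c i r * v j r) * y j)"
        unfolding u_def sum_distrib_left sum_distrib_right
        by (subst sum.swap) (simp add: mult_ac)
      then show ?thesis using y(2)[OF that] by simp
    qed
    have Mu: "(\<Sum>s<k. of_real (M $$ (r, s)) * u s) = (\<Sum>i\<in>T. of_real (l i) * (y i * v i r))"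
      if "r < k" for r
    proof -
      have "(\<Sum>s<k. of_real (M $$ (r, s)) * u s)
          = (\<Sum>i\<in>T. y i * (\<Sum>s<k. of_real (M $$ (r, s)) * v i s))"
        unfolding u_def sum_distrib_left by (subst sum.swap) (simp add: mult_ac)
      also have "\<dots> = (\<Sum>i\<in>T. of_real (l i) * (y i * v i r))"
        using eig[OF _ that] T by (intro sum.cong) auto
      finally show ?thesis .
    qed
    have vu: "(\<Sum>r<k. v i r * cnj (u r)) = cnj (y i)" if "i \<in> T" for i
    proof -
      have "(\<Sum>r<k. v i r * cnj (u r)) = (\<Sum>j\<in>T. cnj (y j) * (\<Sum>r<k. v i r * cnj (v j r)))"
        unfolding u_def cnj_sum sum_distrib_left by (subst sum.swap) (simp add: mult_ac)
      also have "\<dots> = (\<Sum>j\<in>T. if i = j then cnj (y j) else 0)"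
        using T that by (intro sum.cong) (auto simp: orth subset_iff)
      finally show ?thesis using that finT by simp
    qed
    have "\<exists>r\<in>{..<k}. u r \<noteq> 0"
    proof (rule ccontr)
      assume "\<not> (\<exists>r\<in>{..<k}. u r \<noteq> 0)"
      then have "y i = 0" if "i \<in> T" for i using vu[OF that] by simp
      then show False using y(1) by blast
    qed
    moreover have "(\<Sum>r<k. \<Sum>s<k. cnj (u r) * of_real (M $$ (r, s)) * u s)
        = of_real (\<Sum>i\<in>T. l i * (cmod (y i))\<^sup>2)"
    proof -
      have "(\<Sum>r<k. \<Sum>s<k. cnj (u r) * of_real (M $$ (r, s)) * u s)
          = (\<Sum>r<k. cnj (u r) * (\<Sum>i\<in>T. of_real (l i) * (y i * v i r)))"
        using Mu by (intro sum.cong) (simp_all add: mult.assoc flip: sum_distrib_left)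
      also have "\<dots> = (\<Sum>i\<in>T. of_real (l i) * (y i * (\<Sum>r<k. v i r * cnj (u r))))"
        unfolding sum_distrib_left by (subst sum.swap) (simp add: mult_ac)
      also have "\<dots> = (\<Sum>i\<in>T. of_real (l i * (cmod (y i))\<^sup>2))"
        by (intro sum.cong) (simp_all only: vu of_real_mult complex_norm_square)
      finally show ?thesis by simp
    qed
    ultimately show ?thesis using y(1) cu Mu
      by (intro exI[of _ y] exI[of _ u] conjI ballI allI impI) (simp_all only: Re_complex_of_real)
  qed
  \<comment> \<open>A surplus of positive eigenvalues would give a vector killed by the forms in
    \<open>P\<close> on which the Hermitian form is positive, against \<open>pos\<close>.\<close>
  have "card {i. i < k \<and> l i > 0} \<le> card P"
  proof (rule ccontr)
    let ?T = "{i. i < k \<and> l i > 0}"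
    assume "\<not> card ?T \<le> card P"
    then have less: "card P < card ?T" by simp
    have sub: "?T \<subseteq> {..<k}" by auto
    obtain y u where "\<exists>i\<in>?T. y i \<noteq> 0" "\<forall>i\<in>P. (\<Sum>r<k. p i r * u r) = 0" and
      q: "Re (\<Sum>r<k. \<Sum>s<k. cnj (u r) * of_real (M $$ (r, s)) * u s) = (\<Sum>i\<in>?T. l i * (cmod (y i))\<^sup>2)"
      using combination[OF sub fin(1) less, of p]
      by (elim exE conjE) (rule that)
    then have "(\<Sum>i\<in>?T. l i * (cmod (y i))\<^sup>2) \<le> 0" using pos[of u] by simp
    moreover have "(\<Sum>i\<in>?T. l i * (cmod (y i))\<^sup>2) > 0"
    proof -
      obtain i where "i \<in> ?T" "y i \<noteq> 0" using \<open>\<exists>i\<in>?T. y i \<noteq> 0\<close> by blast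
      then show ?thesis by (intro sum_pos2[of ?T i]) auto
    qed
    ultimately show False by simp
  qed
  moreover have "card {i. i < k \<and> l i < 0} \<le> card N"
  proof (rule ccontr)
    let ?T = "{i. i < k \<and> l i < 0}"
    assume "\<not> card ?T \<le> card N"
    then have less: "card N < card ?T" by simp
    have sub: "?T \<subseteq> {..<k}" by auto
    obtain y u where "\<exists>i\<in>?T. y i \<noteq> 0" "\<forall>i\<in>N. (\<Sum>r<k. n i r * u r) = 0" and
      q: "Re (\<Sum>r<k. \<Sum>s<k. cnj (u r) * of_real (M $$ (r, s)) * u s) = (\<Sum>i\<in>?T. l i * (cmod (y i))\<^sup>2)"
      using combination[OF sub fin(2) less, of n]
      by (elim exE conjE) (rule that)
    then have "(\<Sum>i\<in>?T. l i * (cmod (y i))\<^sup>2) \<ge> 0" using neg[of u] by simp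
    moreover have "(\<Sum>i\<in>?T. - (l i * (cmod (y i))\<^sup>2)) > 0"
    proof -
      obtain i where "i \<in> ?T" "y i \<noteq> 0" using \<open>\<exists>i\<in>?T. y i \<noteq> 0\<close> by blast
      then show ?thesis by (intro sum_pos2[of ?T i]) (auto simp: mult_neg_pos mult_nonpos_nonneg)
    qed
    ultimately show False by (simp add: sum_negf)
  qed
  moreover have "card {i. i < k \<and> l i = 0} \<le> card Z"
  proof (rule ccontr)
    let ?T = "{i. i < k \<and> l i = 0}"
    assume "\<not> card ?T \<le> card Z"
    then have less: "card Z < card ?T" by simp
    have sub: "?T \<subseteq> {..<k}" by auto
    obtain y u where u: "\<exists>r\<in>{..<k}. u r \<noteq> 0" and z: "\<forall>i\<in>Z. (\<Sum>r<k. z i r * u r) = 0" and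
      Mu: "\<forall>r<k. (\<Sum>s<k. of_real (M $$ (r, s)) * u s) = (\<Sum>i\<in>?T. of_real (l i) * (y i * v i r))"
      using combination[OF sub fin(3) less, of z]
      by (elim exE conjE) (rule that)
    have "(\<Sum>s<k. of_real (M $$ (r, s)) * u s) = 0" if "r < k" for r
      using Mu that by (simp add: sum.neutral)
    then have "u r = 0" if "r < k" for r
      using null[of u r] z that by blast
    then show False using u by blast
  qed
  moreover have "card {i. i < k \<and> l i > 0} + card {i. i < k \<and> l i < 0} + card {i. i < k \<and> l i = 0} = k"
  proof -
    have "{..<k} = ({i. i < k \<and> l i > 0} \<union> {i. i < k \<and> l i < 0}) \<union> {i. i < k \<and> l i = 0}" by auto
    then have "card {..<k} = card (({i. i < k \<and> l i > 0} \<union> {i. i < k \<and> l i < 0}) \<union> {i. i < k \<and> l i = 0})"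
      by (rule arg_cong)
    also have "\<dots> = card ({i. i < k \<and> l i > 0} \<union> {i. i < k \<and> l i < 0}) + card {i. i < k \<and> l i = 0}"
      by (rule card_Un_disjoint) auto
    also have "card ({i. i < k \<and> l i > 0} \<union> {i. i < k \<and> l i < 0})
        = card {i. i < k \<and> l i > 0} + card {i. i < k \<and> l i < 0}"
      by (rule card_Un_disjoint) auto
    finally show ?thesis by simp
  qed
  ultimately show ?thesis using card by (simp add: signature_of_roots[OF char])
qed

section \<open>Interpolation\<close>

text \<open>Lagrange interpolation: for each \<open>b\<close> other than \<open>a\<close> choose a
  coordinate \<open>i b\<close> in which they differ, and multiply the affine factors that are 0 at
  \<open>b\<close> and 1 at \<open>a\<close>.\<close>

lemma interpolation_polynomial:
  fixes V :: "('a::field ^ 'n::finite) set"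
  assumes "finite V"
  obtains e where "\<And>b. b \<in> V \<Longrightarrow> meval b e = (if b = a then 1 else 0)"
proof -
  define i where "i b = (SOME i. a $ i \<noteq> b $ i)" for b :: "'a ^ 'n"
  have i: "a $ i b \<noteq> b $ i b" if "b \<noteq> a" for b
    unfolding i_def using that by (intro someI_ex[of "\<lambda>i. a $ i \<noteq> b $ i"]) (metis Finite_Cartesian_Product.vec_eq_iff)
  define e where "e = (\<Prod>b\<in>V - {a}. mconst (inverse (a $ i b - b $ i b)) * (mvar (i b) - mconst (b $ i b)))"
  have ev: "meval x e = (\<Prod>b\<in>V - {a}. inverse (a $ i b - b $ i b) * (x $ i b - b $ i b))" for x
    by (simp add: e_def meval.hom_prod meval_mult meval.hom_minus)
  have "meval a e = 1" using i by (auto simp: ev intro!: prod.neutral)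
  moreover have "meval b e = 0" if "b \<in> V" "b \<noteq> a" for b
    unfolding ev using that assms by (intro prod_zero) auto
  ultimately show ?thesis using that[of e] by auto
qed

section \<open>Complexification of a real ideal\<close>

lemma mpoly_Re_Im:
  "p = complex_mpoly (Poly_Mapping.map Re p) + mconst \<i> * complex_mpoly (Poly_Mapping.map Im p)"
proof (induction p rule: mpoly_induct)
  case (monom \<alpha> c)
  show ?case
    by (simp add: mpoly_map_single complex_mpoly_def mconst_def mmonom_def mult_single
        flip: single_add complex_eq)
next
  case (add p q)
  have "Poly_Mapping.map Re (p + q) = Poly_Mapping.map Re p + Poly_Mapping.map Re q"
    "Poly_Mapping.map Im (p + q) = Poly_Mapping.map Im p + Poly_Mapping.map Im q"
    by (simp_all add: mpoly_map_add)
  then show ?case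
    by (subst (1) add(1), subst (1) add(2)) (simp add: complex_mpoly.hom_add distrib_left add_ac)
qed

lemma mpoly_Re_Im_unique:
  assumes "complex_mpoly x + mconst \<i> * complex_mpoly y = complex_mpoly x' + mconst \<i> * complex_mpoly y'"
  shows "x = x'" "y = y'"
proof -
  have l: "Poly_Mapping.lookup (complex_mpoly p + mconst \<i> * complex_mpoly q) \<alpha>
      = of_real (Poly_Mapping.lookup p \<alpha>) + \<i> * of_real (Poly_Mapping.lookup q \<alpha>)"
    for p q :: "('a, real) mpoly" and \<alpha>
  proof -
    have "Poly_Mapping.lookup (mconst c * r) \<alpha> = c * Poly_Mapping.lookup r \<alpha>"
      for c :: complex and r :: "('a, complex) mpoly"
    proof (induction r rule: mpoly_induct)
      case (monom \<beta> d)
      show ?case by (simp add: mconst_def mmonom_def mult_single lookup_single when_def)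
    qed (simp add: distrib_left lookup_add)
    then show ?thesis by (simp add: lookup_add complex_mpoly_def lookup_mpoly_map)
  qed
  have "of_real (Poly_Mapping.lookup x \<alpha>) + \<i> * of_real (Poly_Mapping.lookup y \<alpha>)
      = of_real (Poly_Mapping.lookup x' \<alpha>) + \<i> * of_real (Poly_Mapping.lookup y' \<alpha>)" for \<alpha>
    using arg_cong[OF assms, of "\<lambda>p. Poly_Mapping.lookup p \<alpha>"] by (simp only: l)
  then show "x = x'" "y = y'"
    by (auto intro!: poly_mapping_eqI simp: complex_eq_iff)
qed

lemma mconst_i_mult_i: "mconst \<i> * (mconst \<i> * p) = - (p :: ('n, complex) mpoly)"
  by (simp add: mconst.hom_mult[symmetric] mconst.hom_uminus flip: mult.assoc)

text \<open>The closure properties of an ideal are stated directly, so that generators are dealt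
  with once, in \<open>ideal_gen_closed\<close>.\<close>

locale radical_zero_dim_ideal =
  fixes I :: "('n::finite, real) mpoly set" and as :: "('n \<Rightarrow>\<^sub>0 nat) list"
  assumes zero: "0 \<in> I" and add: "p \<in> I \<Longrightarrow> q \<in> I \<Longrightarrow> p + q \<in> I"
    and mult: "p \<in> I \<Longrightarrow> r * p \<in> I"
    and radical: "radical_ideal I" and finite_variety: "finite (variety I)"
    and basis: "monomial_basis I as"
begin

text \<open>The ideal that \<open>I\<close> generates in the complex polynomial ring.\<close>

definition J :: "('n, complex) mpoly set" where
  "J = {complex_mpoly x + mconst \<i> * complex_mpoly y | x y. x \<in> I \<and> y \<in> I}"

lemma minus: "p \<in> I \<Longrightarrow> q \<in> I \<Longrightarrow> p - q \<in> I"
  using add[of p "- 1 * q"] mult[of q "- 1"] by simp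

lemma sum: "(\<And>i. i \<in> S \<Longrightarrow> p i \<in> I) \<Longrightarrow> sum p S \<in> I"
  by (induction S rule: infinite_finite_induct) (auto simp: zero add)

text \<open>Uniqueness of real and imaginary parts is the way back from relations over the complex
  numbers to the real ideal.\<close>

lemma J_iff: "complex_mpoly x + mconst \<i> * complex_mpoly y \<in> J \<longleftrightarrow> x \<in> I \<and> y \<in> I"
  unfolding J_def using mpoly_Re_Im_unique by blast

lemma J_of_I: "x \<in> I \<Longrightarrow> complex_mpoly x \<in> J"
  using J_iff[of x 0] zero by simp

lemma J_zero: "0 \<in> J"
  using J_of_I[OF zero] by simp

lemma J_add: assumes "p \<in> J" "q \<in> J" shows "p + q \<in> J"
proof -
  from assms obtain x y x' y' where *: "x \<in> I" "y \<in> I" "x' \<in> I" "y' \<in> I" and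
    p: "p = complex_mpoly x + mconst \<i> * complex_mpoly y" and
    q: "q = complex_mpoly x' + mconst \<i> * complex_mpoly y'"
    unfolding J_def by blast
  have "p + q = complex_mpoly (x + x') + mconst \<i> * complex_mpoly (y + y')"
    by (simp add: p q complex_mpoly.hom_add algebra_simps)
  then show ?thesis using * by (simp add: J_iff add)
qed

lemma J_mult: assumes "p \<in> J" shows "r * p \<in> J"
proof -
  from assms obtain x y where *: "x \<in> I" "y \<in> I" and
    p: "p = complex_mpoly x + mconst \<i> * complex_mpoly y"
    unfolding J_def by blast
  obtain a b where r: "r = complex_mpoly a + mconst \<i> * complex_mpoly b"
    using mpoly_Re_Im by metis
  have "r * p = complex_mpoly (a * x - b * y) + mconst \<i> * complex_mpoly (a * y + b * x)"
    using mconst_i_mult_i[of "complex_mpoly b * complex_mpoly y"]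
    by (simp add: p r complex_mpoly.hom_add complex_mpoly.hom_minus complex_mpoly.hom_mult algebra_simps)
  moreover have "a * x - b * y \<in> I" "a * y + b * x \<in> I"
    using * by (simp_all add: mult add minus)
  ultimately show ?thesis by (simp only: J_iff)
qed

lemma J_minus: "p \<in> J \<Longrightarrow> q \<in> J \<Longrightarrow> p - q \<in> J"
  using J_add[of p "- 1 * q"] J_mult[of q "- 1"] by simp

lemma J_cancel_const: assumes "c \<noteq> 0" "mconst c * p \<in> J" shows "p \<in> J"
  using J_mult[OF assms(2), of "mconst (inverse c)"] assms(1)
  by (simp flip: mult.assoc mconst.hom_mult)

lemma radicalD: "p ^ k \<in> I \<Longrightarrow> k \<ge> 1 \<Longrightarrow> p \<in> I"
  using radical unfolding radical_ideal_def by blast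

text \<open>For p = q + ir, the square gives q^2 - r^2 and 2qr in \<open>I\<close>. Hence q^4 = q^2
  (q^2 - r^2) + (qr)^2 is in \<open>I\<close>, so q is, and then r^2 is. Squares suffice for the
  Nullstellensatz below.\<close>

lemma J_radical: assumes "p * p \<in> J" shows "p \<in> J"
proof -
  obtain q r where p: "p = complex_mpoly q + mconst \<i> * complex_mpoly r"
    using mpoly_Re_Im by metis
  have "p * p = complex_mpoly (q * q - r * r) + mconst \<i> * complex_mpoly (q * r + q * r)"
    using mconst_i_mult_i[of "complex_mpoly r * complex_mpoly r"]
      complex_mpoly.hom_add[of "1 :: ('n, real) mpoly" 1]
    by (simp add: p complex_mpoly.hom_add complex_mpoly.hom_minus complex_mpoly.hom_mult algebra_simps)
  then have 1: "q * q - r * r \<in> I" and 2: "q * r + q * r \<in> I" using assms by (simp_all only: J_iff)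
  have half: "mconst (1/2) + mconst (1/2) = (1 :: ('n, real) mpoly)" by (simp flip: mconst.hom_add)
  have "mconst (1/2) * (q * r + q * r) = (mconst (1/2) + mconst (1/2)) * (q * r)"
    by (simp only: distrib_left distrib_right)
  then have 3: "q * r \<in> I" using mult[OF 2, of "mconst (1/2)"] by (simp only: half mult_1)
  have "q ^ 4 = (q * q) * (q * q - r * r) + (q * r) * (q * r)"
    by (simp add: power4_eq_xxxx algebra_simps)
  then have "q ^ 4 \<in> I" using mult[OF 1] mult[OF 3] add by simp
  then have q: "q \<in> I" by (rule radicalD) simp
  have "r ^ 2 = q * q - (q * q - r * r)" by (simp add: power2_eq_square)
  then have "r ^ 2 \<in> I" using minus[OF mult[OF q, of q] 1] by (simp only:)
  then have "r \<in> I" by (rule radicalD) simp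
  then show ?thesis using q by (simp add: p J_iff)
qed

section \<open>The Nullstellensatz in the finite-dimensional case\<close>

lemma variety_zero: "a \<in> variety I \<Longrightarrow> p \<in> J \<Longrightarrow> meval a p = 0"
  by (auto simp: J_def variety_def meval_add meval_mult)

lemma basis_span: "\<exists>c. p - lin_comb as c \<in> I"
  using basis unfolding monomial_basis_def by blast

lemma basis_indep: "lin_comb as c \<in> I \<Longrightarrow> j < length as \<Longrightarrow> c j = 0"
  using basis unfolding monomial_basis_def by blast

text \<open>The powers of \<open>mvar i\<close> up to exponent \<open>length as\<close> have one
  more coordinate vector than there are coordinates, hence satisfy a linear relation modulo
  \<open>I\<close>.\<close>

lemma annihilating_polynomial:
  obtains q where "q \<noteq> 0" "poly (map_poly mconst q) (mvar i) \<in> J"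
proof -
  let ?k = "length as"
  have "\<exists>d. mvar i ^ j - lin_comb as d \<in> I" for j by (rule basis_span)
  then obtain d where d: "\<And>j. mvar i ^ j - lin_comb as (d j) \<in> I" by metis
  obtain y where y: "\<exists>j\<in>{..?k}. y j \<noteq> 0" "\<And>s. s \<in> {..<?k} \<Longrightarrow> (\<Sum>j\<le>?k. d j s * y j) = 0"
    using homogeneous_system[of "{..<?k}" "{..?k}" "\<lambda>s j. d j s"] by auto
  \<comment> \<open>The reduced parts cancel under the weights \<open>y\<close>, which leaves only
    differences that lie in \<open>I\<close>.\<close>
  have "(\<Sum>j\<le>?k. mconst (y j) * lin_comb as (d j)) = (\<Sum>s<?k. mmonom (as ! s) (\<Sum>j\<le>?k. d j s * y j))"
    unfolding lin_comb_def sum_distrib_left mconst_mult_mmonom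
    by (subst sum.swap) (simp add: mmonom_sum mult.commute)
  also have "\<dots> = 0" using y(2) by (simp add: mmonom_def)
  finally have 0: "(\<Sum>j\<le>?k. mconst (y j) * mvar i ^ j)
      = (\<Sum>j\<le>?k. mconst (y j) * (mvar i ^ j - lin_comb as (d j)))"
    by (simp add: right_diff_distrib sum_subtractf)
  have "(\<Sum>j\<le>?k. mconst (y j) * mvar i ^ j) \<in> I"
    unfolding 0 by (intro sum mult d)
  then have "(\<Sum>j\<le>?k. complex_mpoly (mconst (y j) * mvar i ^ j)) \<in> J"
    unfolding complex_mpoly.hom_sum[symmetric] by (rule J_of_I)
  moreover define q where "q = (\<Sum>j\<le>?k. monom (complex_of_real (y j)) j)"
  interpret h: map_poly_comm_ring_hom "mconst :: complex \<Rightarrow> ('n, complex) mpoly" ..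
  have "poly (map_poly mconst q) (mvar i) = (\<Sum>j\<le>?k. complex_mpoly (mconst (y j) * mvar i ^ j))"
    by (simp add: q_def h.hom_sum poly_sum poly_monom complex_mpoly.hom_mult complex_mpoly.hom_power)
  moreover have "q \<noteq> 0"
  proof -
    obtain j where j: "j \<le> ?k" "y j \<noteq> 0" using y(1) by auto
    then have "coeff q j \<noteq> 0" by (simp add: q_def coeff_sum)
    then show ?thesis by auto
  qed
  ultimately show ?thesis using that by metis
qed

text \<open>\<open>K\<close> consists of the polynomials in \<open>mvar i\<close> that annihilate
  \<open>v\<close> modulo \<open>J\<close>; \<open>annihilator_imp_eigen\<close> then produces an
  eigenvector that is a multiple of \<open>v\<close>.\<close>

lemma eigen_multiple_var:
  assumes "v \<notin> J"
  obtains a r where "r * v \<notin> J" "(mvar i - mconst a) * (r * v) \<in> J"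
proof -
  define \<phi> where "\<phi> q = poly (map_poly mconst q) (mvar i)" for q :: "complex poly"
  interpret h: map_poly_comm_ring_hom "mconst :: complex \<Rightarrow> ('n, complex) mpoly" ..
  have \<phi>_mult: "\<phi> (p * q) = \<phi> p * \<phi> q" for p q by (simp add: \<phi>_def h.hom_mult)
  have \<phi>_linear: "\<phi> [:-a, 1:] = mvar i - mconst a" for a by (simp add: \<phi>_def mconst.hom_uminus)
  define K where "K = {q. \<phi> q * v \<in> J}"
  obtain q where q: "q \<noteq> 0" "\<phi> q \<in> J" using annihilating_polynomial unfolding \<phi>_def by blast
  from q(2) have "q \<in> K" using J_mult[of "\<phi> q" v] by (simp add: K_def mult.commute)
  moreover note q(1)
  moreover have "[:c:] \<notin> K" if "c \<noteq> 0" for c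
    using J_cancel_const[OF that] assms by (auto simp: K_def \<phi>_def mconst.map_poly_pCons_hom)
  ultimately obtain a r where "r \<notin> K" "[:-a, 1:] * r \<in> K"
    by (rule annihilator_imp_eigen)
  then show ?thesis
    using that[of "\<phi> r" a] by (simp add: K_def \<phi>_mult \<phi>_linear mult.assoc del: mult_pCons_left)
qed

text \<open>Multiplications commute, so passing to a further multiple keeps the relations for the
  variables already treated.\<close>

lemma eigen_multiple:
  assumes "p \<notin> J" "finite F"
  shows "\<exists>w a. w * p \<notin> J \<and> (\<forall>i\<in>F. (mvar i - mconst (a i)) * (w * p) \<in> J)"
  using assms(2)
proof induction
  case empty
  show ?case using assms(1) by (intro exI[of _ 1]) simp
next
  case (insert i F)
  then obtain w a where wa: "w * p \<notin> J" "\<forall>i\<in>F. (mvar i - mconst (a i)) * (w * p) \<in> J" by blast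
  obtain b r where br: "r * (w * p) \<notin> J" "(mvar i - mconst b) * (r * (w * p)) \<in> J"
    using eigen_multiple_var[OF wa(1)] .
  have "(mvar j - mconst ((a(i := b)) j)) * (r * w * p) \<in> J" if "j \<in> insert i F" for j
  proof (cases "j = i")
    case True
    then show ?thesis using br(2) by (simp add: mult.assoc)
  next
    case False
    then have "r * ((mvar j - mconst (a j)) * (w * p)) \<in> J" using wa(2) that by (auto intro: J_mult)
    then show ?thesis using False by (simp add: mult_ac)
  qed
  then show ?case using br(1) by (metis mult.assoc)
qed

text \<open>Were \<open>p\<close> outside \<open>J\<close>, some multiple \<open>v\<close> of
  \<open>p\<close> outside \<open>J\<close> would be a common eigenvector of the variables, on which
  every \<open>r\<close> acts as its value at the point \<open>x\<close> of eigenvalues. Elements of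
  \<open>I\<close> annihilate \<open>v\<close>, so they vanish at \<open>x\<close>; hence so does
  \<open>p\<close>. Then \<open>p\<close> annihilates \<open>v\<close>, so \<open>v * v\<close> is
  in \<open>J\<close>, against \<open>J_radical\<close>.\<close>

theorem nullstellensatz:
  assumes "\<And>a. a \<in> variety I \<Longrightarrow> meval a p = 0"
  shows "p \<in> J"
proof (rule ccontr)
  assume "p \<notin> J"
  then obtain w a where w: "w * p \<notin> J" and a: "\<And>i. (mvar i - mconst (a i)) * (w * p) \<in> J"
    using eigen_multiple[OF _ finite, of p UNIV] by blast
  define v where "v = w * p"
  define x where "x = (\<chi> i. a i)"
  have ev: "(r - mconst (meval x r)) * v \<in> J" for r
  proof (induction r rule: mpoly_ring_induct)
    case (const c)
    show ?case by (simp add: J_zero)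
  next
    case (var i)
    show ?case using a by (simp add: x_def v_def)
  next
    case (add r s)
    have "(r + s - mconst (meval x (r + s))) * v
        = (r - mconst (meval x r)) * v + (s - mconst (meval x s)) * v"
      by (simp add: meval_add mconst.hom_add algebra_simps)
    then show ?case using add J_add by simp
  next
    case (mult r s)
    have "(r * s - mconst (meval x (r * s))) * v
        = r * ((s - mconst (meval x s)) * v) + mconst (meval x s) * ((r - mconst (meval x r)) * v)"
      by (simp add: meval_mult mconst.hom_mult algebra_simps)
    then show ?case using mult J_add J_mult by simp
  qed
  have "meval x (complex_mpoly f) = 0" if "f \<in> I" for f
  proof (rule ccontr)
    assume nz: "meval x (complex_mpoly f) \<noteq> 0"
    have "complex_mpoly f * v \<in> J" using J_mult[OF J_of_I[OF that], of v] by (simp add: mult.commute)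
    then have "complex_mpoly f * v - (complex_mpoly f - mconst (meval x (complex_mpoly f))) * v \<in> J"
      using ev by (rule J_minus)
    then have "mconst (meval x (complex_mpoly f)) * v \<in> J"
      by (simp add: left_diff_distrib)
    then show False using J_cancel_const[OF nz] w v_def by blast
  qed
  then have "meval x p = 0" by (intro assms) (simp add: variety_def)
  then have "w * (p * v) \<in> J" using ev[of p] by (simp add: J_mult)
  then have "v * v \<in> J" by (simp add: v_def mult_ac)
  then show False using J_radical w v_def by blast
qed

section \<open>Hermite matrices as sums over the variety\<close>

definition E :: "complex ^ 'n \<Rightarrow> nat \<Rightarrow> complex" where
  "E a j = meval a (mmonom (as ! j) 1)"

text \<open>\<open>G\<close> holds the coordinates of the interpolation polynomials of the points of the variety; it
  is the inverse of the evaluation matrix \<open>E\<close>.\<close>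

definition G :: "nat \<Rightarrow> complex ^ 'n \<Rightarrow> complex" where
  "G = (SOME G. \<forall>a\<in>variety I. \<forall>b\<in>variety I. (\<Sum>j<length as. E b j * G j a) = (if b = a then 1 else 0))"

abbreviation k :: nat where "k \<equiv> length as"

lemma meval_lin_comb: "meval a (complex_mpoly (lin_comb as c)) = (\<Sum>j<k. E a j * of_real (c j))"
proof -
  have "mmonom (as ! j) (complex_of_real (c j)) = mconst (of_real (c j)) * mmonom (as ! j) 1" for j
    by (simp add: mconst_mult_mmonom)
  then show ?thesis
    by (simp add: lin_comb_def complex_mpoly.hom_sum meval.hom_sum E_def meval_mult mult.commute)
qed

text \<open>Real and imaginary parts reduce separately modulo \<open>I\<close>, so the real basis
  also represents complex polynomials.\<close>

lemma E_span: "\<exists>d. \<forall>a\<in>variety I. meval a p = (\<Sum>j<k. E a j * d j)"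
proof -
  obtain x y where p: "p = complex_mpoly x + mconst \<i> * complex_mpoly y"
    using mpoly_Re_Im by metis
  obtain c where c: "x - lin_comb as c \<in> I" using basis_span by blast
  obtain d where d: "y - lin_comb as d \<in> I" using basis_span by blast
  have eq: "meval a (complex_mpoly q) = (\<Sum>j<k. E a j * of_real (e j))"
    if "a \<in> variety I" "q - lin_comb as e \<in> I" for a q e
    using variety_zero[OF that(1) J_of_I[OF that(2)]]
    by (simp add: complex_mpoly.hom_minus meval.hom_minus meval_lin_comb)
  have "meval a p = (\<Sum>j<k. E a j * (of_real (c j) + \<i> * of_real (d j)))" if "a \<in> variety I" for a
    using eq[OF that c] eq[OF that d]
    by (simp add: p meval_add meval_mult distrib_left sum.distrib sum_distrib_left mult.left_commute)
  then show ?thesis by (intro exI[of _ "\<lambda>j. of_real (c j) + \<i> * of_real (d j)"] ballI)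
qed

text \<open>The Nullstellensatz puts the combination with coefficients \<open>d\<close> into
  \<open>J\<close>; its real and imaginary parts then lie in \<open>I\<close>, where the basis is
  independent.\<close>

lemma E_inj:
  assumes "\<And>a. a \<in> variety I \<Longrightarrow> (\<Sum>j<k. E a j * d j) = 0" "j < k"
  shows "d j = 0"
proof -
  let ?x = "lin_comb as (\<lambda>j. Re (d j))" and ?y = "lin_comb as (\<lambda>j. Im (d j))"
  have "meval a (complex_mpoly ?x + mconst \<i> * complex_mpoly ?y) = (\<Sum>j<k. E a j * d j)" for a
  proof -
    have "E a j * d j = E a j * of_real (Re (d j)) + \<i> * (E a j * of_real (Im (d j)))" for j
      by (subst complex_eq[of "d j"]) (simp add: distrib_left mult.left_commute)
    then show ?thesis
      by (simp add: meval_add meval_mult meval_lin_comb sum.distrib sum_distrib_left)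
  qed
  then have "complex_mpoly ?x + mconst \<i> * complex_mpoly ?y \<in> J"
    using assms(1) by (intro nullstellensatz) simp
  then have "?x \<in> I" "?y \<in> I" by (simp_all only: J_iff)
  then have "Re (d j) = 0" "Im (d j) = 0" using basis_indep[OF _ assms(2)] by blast+
  then show ?thesis by (simp add: complex_eq_iff)
qed

text \<open>Justifies the choice of \<open>G\<close>: reduced interpolation polynomials supply a
  witness.\<close>

lemma E_G:
  assumes "a \<in> variety I" "b \<in> variety I"
  shows "(\<Sum>j<k. E b j * G j a) = (if b = a then 1 else 0)"
proof -
  have "\<exists>g. \<forall>b\<in>variety I. (\<Sum>j<k. E b j * g j) = (if b = a then 1 else 0)" for a
  proof -
    obtain e where "\<And>b. b \<in> variety I \<Longrightarrow> meval b e = (if b = a then 1 else 0)"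
      using interpolation_polynomial[OF finite_variety, where a = a] by blast
    moreover obtain d where "\<forall>b\<in>variety I. meval b e = (\<Sum>j<k. E b j * d j)" using E_span by blast
    ultimately show ?thesis by (intro exI[of _ d]) simp
  qed
  then obtain g where "\<And>a. \<forall>b\<in>variety I. (\<Sum>j<k. E b j * g a j) = (if b = a then 1 else 0)"
    by metis
  then have "\<exists>G. \<forall>a\<in>variety I. \<forall>b\<in>variety I. (\<Sum>j<k. E b j * G j a) = (if b = a then 1 else 0)"
    by (intro exI[of _ "\<lambda>j a. g a j"]) simp
  from someI_ex[OF this, folded G_def] show ?thesis using assms by blast
qed

lemma sum_variety_delta: "b \<in> variety I \<Longrightarrow> (\<Sum>a\<in>variety I. f a * (if b = a then 1 else 0)) = (f b :: complex)"
  by (simp add: finite_variety if_distrib cong: if_cong)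

lemma E_sum_G:
  assumes "b \<in> variety I"
  shows "(\<Sum>i<k. E b i * (\<Sum>a\<in>variety I. f a * G i a)) = f b"
proof -
  have "(\<Sum>i<k. E b i * (\<Sum>a\<in>variety I. f a * G i a)) = (\<Sum>a\<in>variety I. f a * (\<Sum>i<k. E b i * G i a))"
    unfolding sum_distrib_left by (subst sum.swap) (simp add: mult.left_commute)
  also have "\<dots> = (\<Sum>a\<in>variety I. f a * (if b = a then 1 else 0))"
    using assms by (intro sum.cong) (simp_all only: E_G)
  finally show ?thesis using sum_variety_delta[OF assms] by simp
qed

text \<open>\<open>E\<close> is not yet known to be square, so its right inverse need not be a left
  inverse for formal reasons; \<open>E_inj\<close> compares the two coordinate vectors through their
  values.\<close>

lemma G_E:
  assumes "i < k" "j < k"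
  shows "(\<Sum>a\<in>variety I. E a j * G i a) = (if i = j then 1 else 0)"
proof -
  have "(\<Sum>a\<in>variety I. E a j * G i a) - (if i = j then 1 else 0) = 0"
  proof (rule E_inj[OF _ assms(1)])
    fix b assume b: "b \<in> variety I"
    have "(\<Sum>i<k. E b i * (if i = j then 1 else 0)) = E b j"
      using assms(2) by (simp add: if_distrib cong: if_cong)
    then show "(\<Sum>i<k. E b i * ((\<Sum>a\<in>variety I. E a j * G i a) - (if i = j then 1 else 0))) = 0"
      using E_sum_G[OF b, of "\<lambda>a. E a j"] by (simp add: right_diff_distrib sum_subtractf)
  qed
  then show ?thesis by simp
qed

text \<open>Cyclicity of the trace, for \<open>G D E\<close> with \<open>D\<close> the diagonal
  matrix of \<open>f\<close>. Taking \<open>f\<close> constantly 1 counts the points of the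
  variety.\<close>

lemma sum_E_G_diag: "(\<Sum>i<k. \<Sum>a\<in>variety I. f a * (E a i * G i a)) = (\<Sum>a\<in>variety I. f a)"
  by (subst sum.swap) (simp add: E_G flip: sum_distrib_left)

lemma card_variety: "card (variety I) = k"
proof -
  have "(\<Sum>i<k. \<Sum>a\<in>variety I. 1 * (E a i * G i a)) = of_nat k"
    by (simp add: G_E)
  then show ?thesis by (subst (asm) sum_E_G_diag) simp
qed

text \<open>This is the factorization \<open>G D E\<close>. Both sides are coordinates in the basis
  with the same values at every point, so \<open>E_inj\<close> identifies them.\<close>

lemma mult_matrix_entry:
  assumes "i < k" "j < k"
  shows "of_real (mult_matrix I as p $$ (i, j))
    = (\<Sum>a\<in>variety I. meval a (complex_mpoly p) * E a j * G i a)"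
proof -
  let ?c = "coords I as (p * mmonom (as ! j) 1)"
  have c: "p * mmonom (as ! j) 1 - lin_comb as ?c \<in> I"
    unfolding coords_def by (rule someI_ex[OF basis_span])
  have "of_real (?c i) - (\<Sum>a\<in>variety I. meval a (complex_mpoly p) * E a j * G i a) = 0"
  proof (rule E_inj[OF _ assms(1)])
    fix b assume b: "b \<in> variety I"
    have "meval b (complex_mpoly p) * E b j = (\<Sum>i<k. E b i * of_real (?c i))"
      using variety_zero[OF b J_of_I[OF c]]
      by (simp add: complex_mpoly.hom_minus complex_mpoly.hom_mult meval.hom_minus meval_mult
          meval_lin_comb flip: E_def)
    then show "(\<Sum>i<k. E b i * (of_real (?c i)
        - (\<Sum>a\<in>variety I. meval a (complex_mpoly p) * E a j * G i a))) = 0"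
      using E_sum_G[OF b, of "\<lambda>a. meval a (complex_mpoly p) * E a j"]
      by (simp add: right_diff_distrib sum_subtractf)
  qed
  then show ?thesis using assms by (simp add: mult_matrix_def)
qed

lemma trace_mult_matrix:
  "of_real (mat_tr (mult_matrix I as p)) = (\<Sum>a\<in>variety I. meval a (complex_mpoly p))"
proof -
  have "dim_row (mult_matrix I as p) = k" by (simp add: mult_matrix_def)
  then have "of_real (mat_tr (mult_matrix I as p))
      = (\<Sum>i<k. \<Sum>a\<in>variety I. meval a (complex_mpoly p) * (E a i * G i a))"
    by (simp add: mat_tr_def mult_matrix_entry mult.assoc)
  then show ?thesis by (simp only: sum_E_G_diag)
qed

lemma hermite_matrix_entry:
  assumes "i < k" "j < k"
  shows "of_real (hermite_matrix I as h $$ (i, j))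
    = (\<Sum>a\<in>variety I. meval a (complex_mpoly h) * E a i * E a j)"
proof -
  have "mmonom (as ! i + as ! j) 1 = mmonom (as ! i) 1 * mmonom (as ! j) (1::real)"
    by (simp add: mmonom_def mult_single)
  then show ?thesis using assms
    by (simp add: hermite_matrix_def trace_mult_matrix complex_mpoly.hom_mult meval_mult E_def mult.assoc)
qed

lemma hermite_matrix_carrier: "hermite_matrix I as h \<in> carrier_mat k k"
  by (simp add: hermite_matrix_def)

lemma hermite_matrix_sym:
  "i < k \<Longrightarrow> j < k \<Longrightarrow> hermite_matrix I as h $$ (i, j) = hermite_matrix I as h $$ (j, i)"
  by (simp add: hermite_matrix_def add.commute)

section \<open>Hermite's theorem\<close>

definition cj :: "complex ^ 'n \<Rightarrow> complex ^ 'n" where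
  "cj a = (\<chi> i. cnj (a $ i))"

lemma cj_cj [simp]: "cj (cj a) = a"
  by (simp add: cj_def)

lemma meval_cj: "meval (cj a) (complex_mpoly p) = cnj (meval a (complex_mpoly p))"
  by (simp add: cj_def meval_cnj)

lemma cj_variety: "a \<in> variety I \<Longrightarrow> cj a \<in> variety I"
  by (simp add: variety_def meval_cj)

lemma E_cj: "E (cj a) j = cnj (E a j)"
  using meval_cj[of a "mmonom (as ! j) 1"] by (simp add: E_def)

text \<open>The value at \<open>a\<close> of the polynomial with complex coordinates
  \<open>u\<close>.\<close>

definition L :: "complex ^ 'n \<Rightarrow> (nat \<Rightarrow> complex) \<Rightarrow> complex" where
  "L a u = (\<Sum>r<k. E a r * u r)"

lemma hermite_matrix_mult_vec:
  assumes "r < k"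
  shows "(\<Sum>s<k. of_real (hermite_matrix I as h $$ (r, s)) * u s)
    = (\<Sum>a\<in>variety I. meval a (complex_mpoly h) * E a r * L a u)"
proof -
  have "(\<Sum>s<k. of_real (hermite_matrix I as h $$ (r, s)) * u s)
      = (\<Sum>s<k. \<Sum>a\<in>variety I. meval a (complex_mpoly h) * E a r * (E a s * u s))"
    using assms by (simp add: hermite_matrix_entry sum_distrib_right mult.assoc)
  then show ?thesis unfolding L_def sum_distrib_left by (subst (asm) sum.swap)
qed

text \<open>Conjugating \<open>u\<close> but not \<open>E a r\<close> amounts to evaluating at
  \<open>cj a\<close> and conjugating the result, by \<open>E_cj\<close>.\<close>

lemma hermite_form:
  "(\<Sum>r<k. \<Sum>s<k. cnj (u r) * of_real (hermite_matrix I as h $$ (r, s)) * u s)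
    = (\<Sum>a\<in>variety I. meval a (complex_mpoly h) * cnj (L (cj a) u) * L a u)"
proof -
  have "(\<Sum>r<k. \<Sum>s<k. cnj (u r) * of_real (hermite_matrix I as h $$ (r, s)) * u s)
      = (\<Sum>r<k. cnj (u r) * (\<Sum>s<k. of_real (hermite_matrix I as h $$ (r, s)) * u s))"
    by (simp add: sum_distrib_left mult.assoc)
  also have "\<dots> = (\<Sum>r<k. \<Sum>a\<in>variety I. cnj (u r) * (meval a (complex_mpoly h) * E a r * L a u))"
    by (simp add: hermite_matrix_mult_vec sum_distrib_left)
  also have "\<dots> = (\<Sum>a\<in>variety I. \<Sum>r<k. cnj (u r) * (meval a (complex_mpoly h) * E a r * L a u))"
    by (rule sum.swap)
  also have "\<dots> = (\<Sum>a\<in>variety I. meval a (complex_mpoly h) * cnj (L (cj a) u) * L a u)"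
    unfolding L_def[of "cj _"] by (simp add: E_cj sum_distrib_left sum_distrib_right mult_ac)
  finally show ?thesis .
qed

text \<open>A pair of conjugate points contributes
  \<open>2 Re (h s (cnj t)) = (|h s + t|\<^sup>2 - |h s - t|\<^sup>2) / 2\<close> to the Hermitian form, hence one
  positive and one negative square.\<close>

theorem hermite:
  "matrix_signature (hermite_matrix I as h)
    = int (card {a \<in> variety I. cj a = a \<and> Re (meval a (complex_mpoly h)) > 0})
    - int (card {a \<in> variety I. cj a = a \<and> Re (meval a (complex_mpoly h)) < 0})"
proof -
  define w where "w a = meval a (complex_mpoly h)" for a
  have w_cj: "w (cj a) = cnj (w a)" for a by (simp add: w_def meval_cj)
  define R where "R = {a \<in> variety I. cj a = a}"
  have w_real: "w a = of_real (Re (w a))" if "a \<in> R" for a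
    using w_cj[of a] that by (simp add: R_def complex_eq_iff)
  \<comment> \<open>An arbitrary numbering, which serves only to select in \<open>S\<close> one
    point of each pair of distinct conjugates.\<close>
  obtain e :: "complex ^ 'n \<Rightarrow> nat" where e: "inj_on e (variety I)"
    using finite_imp_inj_to_nat_seg[OF finite_variety] by blast
  define S where "S = {a \<in> variety I. e a < e (cj a)}"
  have V: "variety I = (R \<union> S) \<union> cj ` S"
  proof
    show "variety I \<subseteq> (R \<union> S) \<union> cj ` S"
    proof
      fix a assume a: "a \<in> variety I"
      consider "e a = e (cj a)" | "e a < e (cj a)" | "e (cj a) < e a" by linarith
      then show "a \<in> (R \<union> S) \<union> cj ` S"
      proof cases
        case 1
        then show ?thesis using a cj_variety[OF a] e by (auto simp: R_def inj_on_def)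
      next
        case 2
        then show ?thesis using a by (simp add: S_def)
      next
        case 3
        then have "cj a \<in> S" using cj_variety[OF a] by (simp add: S_def)
        then show ?thesis by (metis UnI2 cj_cj imageI)
      qed
    qed
  qed (auto simp: R_def S_def cj_variety)
  have fin: "finite R" "finite S" using finite_variety by (auto simp: R_def S_def)
  have disj: "R \<inter> S = {}" "(R \<union> S) \<inter> cj ` S = {}"
    by (auto simp: R_def S_def)
  have inj: "inj_on cj T" for T by (rule inj_on_inverseI[of _ cj]) simp
  \<comment> \<open>A nonreal pair takes part in the count twice: once in \<open>P\<close> and once
    in \<open>N\<close> if \<open>w\<close> is nonzero there, and with both points in
    \<open>Z\<close> otherwise.\<close>
  define P where "P = {a \<in> R. Re (w a) > 0} \<union> {a \<in> S. w a \<noteq> 0}"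
  define N where "N = {a \<in> R. Re (w a) < 0} \<union> {a \<in> S. w a \<noteq> 0}"
  define Z where "Z = {a \<in> variety I. w a = 0}"
  \<comment> \<open>On a nonreal pair, vanishing of \<open>p a\<close> makes
    \<open>w a * L a u\<close> equal to \<open>- L (cj a) u\<close>, so its cross term is minus a
    square; vanishing of \<open>n a\<close> makes it plus a square.\<close>
  define p where "p a r = (if a \<in> R then E a r else w a * E a r + E (cj a) r)" for a r
  define n where "n a r = (if a \<in> R then E a r else w a * E a r - E (cj a) r)" for a r
  have p_R: "(\<Sum>r<k. p a r * u r) = L a u" and n_R: "(\<Sum>r<k. n a r * u r) = L a u"
    if "a \<in> R" for a u using that by (simp_all add: p_def n_def L_def)
  have p_S: "(\<Sum>r<k. p a r * u r) = w a * L a u + L (cj a) u"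
    and n_S: "(\<Sum>r<k. n a r * u r) = w a * L a u - L (cj a) u" if "a \<in> S" for a u
  proof -
    have "a \<notin> R" using that disj by blast
    then show "(\<Sum>r<k. p a r * u r) = w a * L a u + L (cj a) u"
      "(\<Sum>r<k. n a r * u r) = w a * L a u - L (cj a) u"
      by (simp_all add: p_def n_def L_def sum_distrib_left sum.distrib sum_subtractf
          distrib_right left_diff_distrib mult.assoc)
  qed
  have form: "Re (\<Sum>r<k. \<Sum>s<k. cnj (u r) * of_real (hermite_matrix I as h $$ (r, s)) * u s)
      = (\<Sum>a\<in>R. Re (w a) * (cmod (L a u))\<^sup>2) + (\<Sum>a\<in>S. 2 * Re (w a * L a u * cnj (L (cj a) u)))" for u
  proof -
    let ?f = "\<lambda>a. w a * cnj (L (cj a) u) * L a u"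
    have "(\<Sum>a\<in>variety I. ?f a) = (\<Sum>a\<in>R. ?f a) + (\<Sum>a\<in>S. ?f a) + (\<Sum>a\<in>cj ` S. ?f a)"
      unfolding V using fin disj by (simp add: sum.union_disjoint)
    moreover have "(\<Sum>a\<in>cj ` S. ?f a) = (\<Sum>a\<in>S. cnj (?f a))"
      by (simp add: sum.reindex[OF inj] w_cj mult_ac)
    moreover have "Re (?f a) = Re (w a) * (cmod (L a u))\<^sup>2" if "a \<in> R" for a
    proof -
      have "?f a = of_real (Re (w a)) * (L a u * cnj (L a u))"
        using that by (subst w_real) (simp_all add: R_def mult_ac)
      also have "\<dots> = of_real (Re (w a) * (cmod (L a u))\<^sup>2)"
        by (simp only: of_real_mult complex_norm_square)
      finally show ?thesis by (simp only: Re_complex_of_real)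
    qed
    ultimately have "Re (\<Sum>a\<in>variety I. ?f a)
        = (\<Sum>a\<in>R. Re (w a) * (cmod (L a u))\<^sup>2) + (\<Sum>a\<in>S. Re (?f a)) + (\<Sum>a\<in>S. Re (?f a))"
      by (simp only: plus_complex.sel Re_sum cnj.sel cong: sum.cong)
    also have "\<dots> = (\<Sum>a\<in>R. Re (w a) * (cmod (L a u))\<^sup>2) + (\<Sum>a\<in>S. 2 * Re (w a * L a u * cnj (L (cj a) u)))"
    proof -
      have "?f a = w a * L a u * cnj (L (cj a) u)" for a by (simp only: mult_ac)
      then show ?thesis by (simp only: sum.distrib mult_2 add.assoc)
    qed
    finally show ?thesis by (simp only: hermite_form w_def)
  qed
  have "matrix_signature (hermite_matrix I as h) = int (card P) - int (card N)"
  proof (rule signature_by_inertia[OF hermite_matrix_carrier hermite_matrix_sym,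
        where Z = Z and p = p and n = n and z = E])
    show "finite P" "finite N" "finite Z"
      using fin finite_variety by (auto simp: P_def N_def Z_def)
    show "card P + card N + card Z = k"
    proof -
      have Z: "Z = ({a \<in> R. w a = 0} \<union> {a \<in> S. w a = 0}) \<union> cj ` {a \<in> S. w a = 0}"
        using V by (auto simp: Z_def w_cj)
      have "card Z = card {a \<in> R. w a = 0} + card {a \<in> S. w a = 0} + card {a \<in> S. w a = 0}"
        unfolding Z using fin disj
        by (subst card_Un_disjoint, simp, simp, blast, subst card_Un_disjoint, simp, simp, blast)
          (simp add: card_image[OF inj])
      moreover have "card P = card {a \<in> R. Re (w a) > 0} + card {a \<in> S. w a \<noteq> 0}"
        "card N = card {a \<in> R. Re (w a) < 0} + card {a \<in> S. w a \<noteq> 0}"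
        unfolding P_def N_def using fin disj by (auto intro!: card_Un_disjoint)
      moreover have "card {a \<in> R. Re (w a) > 0} + card {a \<in> R. Re (w a) < 0} + card {a \<in> R. w a = 0} = card R"
      proof -
        have "R = ({a \<in> R. Re (w a) > 0} \<union> {a \<in> R. Re (w a) < 0}) \<union> {a \<in> R. w a = 0}"
          using w_real by (auto simp: complex_eq_iff not_less_iff_gr_or_eq)
        also have "card \<dots> = card {a \<in> R. Re (w a) > 0} + card {a \<in> R. Re (w a) < 0} + card {a \<in> R. w a = 0}"
          using fin by (subst card_Un_disjoint, simp, simp, force, subst card_Un_disjoint) auto
        finally show ?thesis by simp
      qed
      moreover have "card {a \<in> S. w a \<noteq> 0} + card {a \<in> S. w a = 0} = card S"
      proof -
        have "S = {a \<in> S. w a \<noteq> 0} \<union> {a \<in> S. w a = 0}" by auto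
        also have "card \<dots> = card {a \<in> S. w a \<noteq> 0} + card {a \<in> S. w a = 0}"
          using fin by (intro card_Un_disjoint) auto
        finally show ?thesis by simp
      qed
      moreover have "k = card R + card S + card S"
        unfolding card_variety[symmetric] V using fin disj
        by (simp add: card_Un_disjoint card_image[OF inj])
      ultimately show ?thesis by linarith
    qed
  next
    fix u assume u: "\<And>a. a \<in> P \<Longrightarrow> (\<Sum>r<k. p a r * u r) = 0"
    have "Re (w a) * (cmod (L a u))\<^sup>2 \<le> 0" if "a \<in> R" for a
      using u[of a] that p_R[OF that, of u]
      by (cases "Re (w a) > 0") (auto simp: P_def mult_nonpos_nonneg)
    moreover have "2 * Re (w a * L a u * cnj (L (cj a) u)) \<le> 0" if "a \<in> S" for a
    proof (cases "w a = 0")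
      case False
      then have "w a * L a u = - L (cj a) u"
        using u[of a] p_S[OF that, of u] that by (simp add: P_def add_eq_0_iff2)
      then show ?thesis by (simp add: complex_mult_cnj)
    qed simp
    ultimately show "Re (\<Sum>r<k. \<Sum>s<k. cnj (u r) * of_real (hermite_matrix I as h $$ (r, s)) * u s) \<le> 0"
      unfolding form by (intro add_nonpos_nonpos sum_nonpos) auto
  next
    fix u assume u: "\<And>a. a \<in> N \<Longrightarrow> (\<Sum>r<k. n a r * u r) = 0"
    have "Re (w a) * (cmod (L a u))\<^sup>2 \<ge> 0" if "a \<in> R" for a
      using u[of a] that n_R[OF that, of u]
      by (cases "Re (w a) < 0") (auto simp: N_def)
    moreover have "2 * Re (w a * L a u * cnj (L (cj a) u)) \<ge> 0" if "a \<in> S" for a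
    proof (cases "w a = 0")
      case False
      then have "w a * L a u = L (cj a) u"
        using u[of a] n_S[OF that, of u] that by (simp add: N_def)
      then show ?thesis by (simp add: complex_mult_cnj)
    qed simp
    ultimately show "Re (\<Sum>r<k. \<Sum>s<k. cnj (u r) * of_real (hermite_matrix I as h $$ (r, s)) * u s) \<ge> 0"
      unfolding form by (intro add_nonneg_nonneg sum_nonneg) auto
  next
    fix u :: "nat \<Rightarrow> complex" and r
    assume ker: "\<And>r. r < k \<Longrightarrow> (\<Sum>s<k. of_real (hermite_matrix I as h $$ (r, s)) * u s) = 0"
      and z: "\<And>a. a \<in> Z \<Longrightarrow> (\<Sum>r<k. E a r * u r) = 0" and "r < k"
    have "L b u = 0" if b: "b \<in> variety I" for b
    proof (cases "w b = 0")
      case True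
      then show ?thesis using z[of b] b by (simp add: Z_def L_def)
    next
      case False
      \<comment> \<open>Pairing the kernel equations with column \<open>b\<close> of
        \<open>G\<close> isolates the term at \<open>b\<close>.\<close>
      have "0 = (\<Sum>r<k. G r b * (\<Sum>a\<in>variety I. w a * E a r * L a u))"
        using ker by (simp add: hermite_matrix_mult_vec w_def)
      also have "\<dots> = (\<Sum>a\<in>variety I. w a * L a u * (\<Sum>r<k. E a r * G r b))"
        unfolding sum_distrib_left by (subst sum.swap) (simp add: mult_ac)
      also have "\<dots> = (\<Sum>a\<in>variety I. w a * L a u * (if b = a then 1 else 0))"
        using b by (intro sum.cong) (auto simp: E_G)
      also have "\<dots> = w b * L b u" by (rule sum_variety_delta[OF b])
      finally show ?thesis using False by simp
    qed
    then show "u r = 0" using E_inj[of u r] \<open>r < k\<close> by (simp add: L_def)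
  qed
  \<comment> \<open>The nonreal pairs enter both cardinalities equally and cancel in the
    difference.\<close>
  moreover have "card P = card {a \<in> R. Re (w a) > 0} + card {a \<in> S. w a \<noteq> 0}"
    "card N = card {a \<in> R. Re (w a) < 0} + card {a \<in> S. w a \<noteq> 0}"
    unfolding P_def N_def using fin disj by (auto intro!: card_Un_disjoint)
  ultimately show ?thesis by (simp add: R_def w_def conj_assoc Collect_conj_eq)
qed

section \<open>From self-conjugate points to real roots\<close>

definition cplx :: "real ^ 'n \<Rightarrow> complex ^ 'n" where
  "cplx x = (\<chi> i. of_real (x $ i))"

lemma meval_cplx: "meval (cplx x) (complex_mpoly p) = of_real (meval x p)"
proof (induction p rule: mpoly_ring_induct)
  case (var i)
  show ?case by (simp add: cplx_def)
qed (simp_all add: complex_mpoly.hom_add complex_mpoly.hom_mult meval_add meval_mult)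

lemma cplx_real_roots: "cplx ` {x \<in> real_roots I. Q x} = {a \<in> variety I. cj a = a \<and> Q (\<chi> i. Re (a $ i))}"
proof (intro equalityI subsetI)
  fix a assume a: "a \<in> {a \<in> variety I. cj a = a \<and> Q (\<chi> i. Re (a $ i))}"
  then have "cnj (a $ i) = a $ i" for i
    by (metis (mono_tags, lifting) cj_def mem_Collect_eq vec_lambda_beta)
  then have eq: "a = cplx (\<chi> i. Re (a $ i))"
    by (simp add: cplx_def Finite_Cartesian_Product.vec_eq_iff complex_eq_iff)
  moreover have "(\<chi> i. Re (a $ i)) \<in> {x \<in> real_roots I. Q x}"
    using a eq by (simp add: real_roots_def cplx_def)
  ultimately show "a \<in> cplx ` {x \<in> real_roots I. Q x}" by (rule image_eqI)
next
  fix a assume "a \<in> cplx ` {x \<in> real_roots I. Q x}"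
  then show "a \<in> {a \<in> variety I. cj a = a \<and> Q (\<chi> i. Re (a $ i))}"
    by (auto simp: real_roots_def cplx_def cj_def)
qed

lemma inj_cplx: "inj cplx"
  by (rule injI) (simp add: cplx_def Finite_Cartesian_Product.vec_eq_iff)

corollary hermite_real_roots:
  "matrix_signature (hermite_matrix I as h)
    = int (card {x \<in> real_roots I. meval x h > 0}) - int (card {x \<in> real_roots I. meval x h < 0})"
proof -
  have "card {a \<in> variety I. cj a = a \<and> Q (Re (meval a (complex_mpoly h)))}
      = card {x \<in> real_roots I. Q (meval x h)}" for Q
  proof -
    have "{a \<in> variety I. cj a = a \<and> Q (Re (meval a (complex_mpoly h)))}
        = {a \<in> variety I. cj a = a \<and> Q (meval (\<chi> i. Re (a $ i)) h)}"
    proof -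
      have "Re (meval a (complex_mpoly h)) = meval (\<chi> i. Re (a $ i)) h"
        if "a \<in> variety I" "cj a = a" for a
      proof -
        have "a \<in> cplx ` {x \<in> real_roots I. True}" using that cplx_real_roots[of "\<lambda>_. True"] by simp
        then obtain x where "a = cplx x" by blast
        moreover have "(\<chi> i. Re (cplx x $ i)) = x" for x by (simp add: cplx_def)
        ultimately show ?thesis by (simp add: meval_cplx)
      qed
      then show ?thesis by auto
    qed
    also have "\<dots> = cplx ` {x \<in> real_roots I. Q (meval x h)}"
      by (rule cplx_real_roots[symmetric])
    finally show ?thesis by (simp add: card_image inj_on_subset[OF inj_cplx])
  qed
  from this[of "\<lambda>t. t > 0"] this[of "\<lambda>t. t < 0"] show ?thesis by (simp add: hermite)
qed

lemma finite_real_roots: "finite (real_roots I)"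
proof -
  have "cplx ` real_roots I \<subseteq> variety I" by (auto simp: real_roots_def cplx_def)
  from finite_subset[OF this finite_variety] show ?thesis
    by (rule finite_imageD[OF _ inj_on_subset[OF inj_cplx subset_UNIV]])
qed

corollary signature_eq_iff:
  "matrix_signature (hermite_matrix I as 1) = matrix_signature (hermite_matrix I as h)
    \<longleftrightarrow> (\<forall>x\<in>real_roots I. meval x h > 0)"
proof -
  let ?p = "{x \<in> real_roots I. meval x h > 0}" and ?n = "{x \<in> real_roots I. meval x h < 0}"
  have "matrix_signature (hermite_matrix I as 1) = int (card (real_roots I))"
    by (simp add: hermite_real_roots)
  then have eq: "matrix_signature (hermite_matrix I as 1) = matrix_signature (hermite_matrix I as h)
      \<longleftrightarrow> int (card (real_roots I)) = int (card ?p) - int (card ?n)"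
    by (simp add: hermite_real_roots)
  show ?thesis
  proof
    assume "matrix_signature (hermite_matrix I as 1) = matrix_signature (hermite_matrix I as h)"
    \<comment> \<open>The negative count can only lower the difference, so the positive count alone
      must exhaust the real roots.\<close>
    then have "card (real_roots I) \<le> card ?p" using eq by linarith
    then have "?p = real_roots I" by (intro card_seteq finite_real_roots) auto
    then show "\<forall>x\<in>real_roots I. meval x h > 0" by blast
  next
    assume pos: "\<forall>x\<in>real_roots I. meval x h > 0"
    then have "?p = real_roots I" "?n = {}" by (auto dest: order_less_asym)
    then show "matrix_signature (hermite_matrix I as 1) = matrix_signature (hermite_matrix I as h)"
      unfolding eq by (simp only: card.empty)
  qed
qed

end

section \<open>The criterion for a ball\<close>

lemma ideal_gen_closed:
  shows "0 \<in> ideal_gen F"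
    and "p \<in> ideal_gen F \<Longrightarrow> q \<in> ideal_gen F \<Longrightarrow> p + q \<in> ideal_gen F"
    and "p \<in> ideal_gen F \<Longrightarrow> r * p \<in> ideal_gen F"
proof -
  interpret Modules.module "(*) :: 'a \<Rightarrow> 'a \<Rightarrow> 'a" by unfold_locales (simp_all add: algebra_simps)
  show "0 \<in> ideal_gen F"
    and "p \<in> ideal_gen F \<Longrightarrow> q \<in> ideal_gen F \<Longrightarrow> p + q \<in> ideal_gen F"
    and "p \<in> ideal_gen F \<Longrightarrow> r * p \<in> ideal_gen F"
    unfolding ideal_gen_def by (fact span_zero, fact span_add, fact span_scale)
qed

theorem corollary7p1:
  fixes m :: nat
    and f :: "nat \<Rightarrow> ('n::finite, rat) mpoly"
    and I :: "('n, real) mpoly set"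
    and as :: "('n \<Rightarrow>\<^sub>0 nat) list"
    and z :: "rat ^ 'n" and \<epsilon> :: rat
    and g :: "('n, rat) mpoly"
  assumes I_eq: "I = ideal_gen ((\<lambda>i. real_mpoly (f i)) ` {1..m})"
    and zero_dim: "zero_dimensional I"
    and radical: "radical_ideal I"
    and basis: "monomial_basis I as"
    and eps: "\<epsilon> \<ge> 0"
    and g_eq: "g = (\<Sum>i\<in>UNIV. (mvar i - mconst (z $ i)) ^ 2) - mconst (\<epsilon> ^ 2)"
  shows "matrix_signature (hermite_matrix I as 1) =
           matrix_signature (hermite_matrix I as (real_mpoly g))
         \<longleftrightarrow> \<not> (\<exists>x \<in> real_roots I. x \<in> cball (\<chi> i. of_rat (z $ i)) (of_rat \<epsilon>))"
proof -
  interpret radical_zero_dim_ideal I as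
    using zero_dim radical basis unfolding zero_dimensional_def
    by unfold_locales (simp_all only: I_eq ideal_gen_closed)
  let ?z = "(\<chi> i. of_rat (z $ i)) :: real ^ 'n"
  have eps': "(of_rat \<epsilon> :: real) \<ge> 0" using eps by simp
  have "meval x (real_mpoly g) = (dist ?z x)\<^sup>2 - (of_rat \<epsilon>)\<^sup>2" for x
  proof -
    have "meval x (real_mpoly g) = (\<Sum>i\<in>UNIV. (x $ i - of_rat (z $ i))\<^sup>2) - (of_rat \<epsilon>)\<^sup>2"
      by (simp add: g_eq real_mpoly.hom_minus real_mpoly.hom_sum real_mpoly.hom_power
          meval.hom_minus meval.hom_sum meval.hom_power of_rat_power)
    also have "(\<Sum>i\<in>UNIV. (x $ i - of_rat (z $ i))\<^sup>2) = (dist ?z x)\<^sup>2"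
      by (simp add: dist_vec_def L2_set_def sum_nonneg dist_real_def power2_commute)
    finally show ?thesis .
  qed
  \<comment> \<open>Nonnegativity of the radius lets squares be compared instead of distances. A
    point of the sphere fails strict positivity, as membership in the closed ball demands.\<close>
  then have "meval x (real_mpoly g) > 0 \<longleftrightarrow> x \<notin> cball ?z (of_rat \<epsilon>)" for x
    using eps' by (simp add: not_le[symmetric] abs_le_square_iff[symmetric])
  then show ?thesis by (simp only: signature_eq_iff) blast
qed

end
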